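(* Let $N\ge 2$, let $W_1,\ldots,W_N$ be invertible bounded linear operators on $\mathcal H$, and let $U\in B(\mathcal H)$ be a unitary operator such that for each $k\in\mathbb N$ there exists $N_k\in\mathbb N$ with $U^n(L_k)\perp L_k$ for all $n\ge N_k$. For each $l\in\{1,\ldots,N\}$ let $T_l$ denote the operator $T_{U,W_l}$ on $B_0(\mathcal H)$. Let $r_1,\ldots,r_N\in\mathbb N$ with $0<r_1<r_2<\cdots<r_N$. Then the following conditions are equivalent. (i) The set of all d-hypercyclic vectors of $T_1^{r_1},\ldots,T_N^{r_N}$ is dense in $B_0(\mathcal H)$. (ii) For each $m\in\mathbb N$ there exist sequences $\{D_k\}_{k=1}^\infty,\{G_k^{(1)}\}_{k=1}^\infty,\ldots,\{G_k^{(N)}\}_{k=1}^\infty$ of operators in $B_0(\mathcal H)$ and a strictly increasing sequence $\{n_k\}_{k=1}^\infty\subseteq\mathbb N$ such that for each $l\in\{1,\ldots,N\}$, $$\lim_{k\to\infty}\|D_k-P_m\|=\lim_{k\to\infty}\|G_k^{(l)}-P_m\|=0,$$ $$\lim_{k\to\infty}\|W_l^{r_ln_k}D_k\|=\lim_{k\to\infty}\|W_l^{-r_ln_k}G_k^{(l)}\|=0,$$ and, for each pair of distinct $s,l\in\{1,\ldots,N\}$, $$\lim_{k\to\infty}\|W_l^{r_ln_k}W_s^{-r_sn_k}G_k^{(s)}\|=0.$$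
   Context: $\mathcal H$ is a separable Hilbert space with an orthonormal basis $\{e_j\}_{j\in\mathbb N}$. For $k\in\mathbb N$, $L_k:=\mathrm{span}\{e_1,\ldots,e_k\}$ and $P_k$ is the orthogonal projection onto $L_k$. $B(\mathcal H)$ is the set of bounded linear operators on $\mathcal H$ and $B_0(\mathcal H)$ the set of compact operators on $\mathcal H$, with the operator norm. For $U,W\in B(\mathcal H)$, $T_{U,W}$ is defined on $B(\mathcal H)$ by $T_{U,W}(F):=WFU$; it maps $B_0(\mathcal H)$ into itself. For $N\ge 2$ and bounded linear operators $T_1,\ldots,T_N$ on a Banach space $\mathcal X$, an element $x\in\mathcal X$ is called a d-hypercyclic vector of $T_1,\ldots,T_N$ if the set $\{(T_1^nx,T_2^nx,\ldots,T_N^nx): n\in\mathbb N\cup\{0\}\}$ is dense in $\mathcal X^N$. *)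

theory Defs
  imports "HOL-Analysis.Analysis"
begin

text \<open>
  A complex Hilbert space carries its underlying real Hilbert space structure, whose inner product
  is the real part of the complex one; so the norm is \<open>sqrt (Re (cinner x x))\<close>.
  \<open>cinner\<close> is linear in its first argument.
\<close>

class complex_hilbert = real_inner + complete_space +
  fixes scaleC :: "complex \<Rightarrow> 'a \<Rightarrow> 'a" (infixr "*\<^sub>C" 75)
    and cinner :: "'a \<Rightarrow> 'a \<Rightarrow> complex"
  assumes scaleC_add_right: "c *\<^sub>C (x + y) = c *\<^sub>C x + c *\<^sub>C y"
    and scaleC_add_left: "(c + d) *\<^sub>C x = c *\<^sub>C x + d *\<^sub>C x"
    and scaleC_scaleC: "c *\<^sub>C d *\<^sub>C x = (c * d) *\<^sub>C x"
    and scaleC_of_real: "complex_of_real a *\<^sub>C x = a *\<^sub>R x"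
    and cinner_commute: "cinner x y = cnj (cinner y x)"
    and cinner_add_left: "cinner (x + y) z = cinner x z + cinner y z"
    and cinner_scaleC_left: "cinner (c *\<^sub>C x) y = c * cinner x y"
    and inner_eq_Re_cinner: "inner x y = Re (cinner x y)"

global_interpretation cvec: vector_space "scaleC :: complex \<Rightarrow> 'a \<Rightarrow> 'a::complex_hilbert"
  using scaleC_of_real[of 1]
  by unfold_locales (simp_all add: scaleC_add_right scaleC_add_left scaleC_scaleC)

definition orthonormal_basis :: "(nat \<Rightarrow> 'h::complex_hilbert) \<Rightarrow> bool" where
  "orthonormal_basis e \<longleftrightarrow>
     (\<forall>i\<ge>1. \<forall>j\<ge>1. cinner (e i) (e j) = (if i = j then 1 else 0)) \<and>
     closure (cvec.span (e ` {1..})) = UNIV"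

definition basis_span :: "(nat \<Rightarrow> 'h::complex_hilbert) \<Rightarrow> nat \<Rightarrow> 'h set" where
  "basis_span e k = cvec.span (e ` {1..k})"

definition orthogonal_sets :: "'h::complex_hilbert set \<Rightarrow> 'h set \<Rightarrow> bool" where
  "orthogonal_sets A B \<longleftrightarrow> (\<forall>x\<in>A. \<forall>y\<in>B. cinner x y = 0)"

text \<open>The type of \<open>blinfun\<close> consists of the bounded \<^emph>\<open>real\<close>-linear maps with the operator norm.\<close>

definition bounded_ops :: "('h::complex_hilbert \<Rightarrow>\<^sub>L 'h) set" where
  "bounded_ops = {A. \<forall>c x. blinfun_apply A (c *\<^sub>C x) = c *\<^sub>C blinfun_apply A x}"

definition compact_ops :: "('h::complex_hilbert \<Rightarrow>\<^sub>L 'h) set" where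
  "compact_ops = {A \<in> bounded_ops. compact (closure (blinfun_apply A ` cball 0 1))}"

definition op_power :: "('h::real_normed_vector \<Rightarrow>\<^sub>L 'h) \<Rightarrow> nat \<Rightarrow> 'h \<Rightarrow>\<^sub>L 'h" where
  "op_power A n = (((o\<^sub>L) A) ^^ n) id_blinfun"

definition invertible_op :: "('h::complex_hilbert \<Rightarrow>\<^sub>L 'h) \<Rightarrow> bool" where
  "invertible_op A \<longleftrightarrow>
     A \<in> bounded_ops \<and> (\<exists>B\<in>bounded_ops. A o\<^sub>L B = id_blinfun \<and> B o\<^sub>L A = id_blinfun)"

definition op_inverse :: "('h::complex_hilbert \<Rightarrow>\<^sub>L 'h) \<Rightarrow> 'h \<Rightarrow>\<^sub>L 'h" where
  "op_inverse A = (THE B. A o\<^sub>L B = id_blinfun \<and> B o\<^sub>L A = id_blinfun)"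

definition unitary_op :: "('h::complex_hilbert \<Rightarrow>\<^sub>L 'h) \<Rightarrow> bool" where
  "unitary_op U \<longleftrightarrow>
     U \<in> bounded_ops \<and> surj (blinfun_apply U) \<and>
     (\<forall>x y. cinner (blinfun_apply U x) (blinfun_apply U y) = cinner x y)"

definition orth_proj :: "'h::complex_hilbert set \<Rightarrow> 'h \<Rightarrow>\<^sub>L 'h" where
  "orth_proj M =
     (THE P. \<forall>x. blinfun_apply P x \<in> M \<and> (\<forall>y\<in>M. cinner (x - blinfun_apply P x) y = 0))"

definition T_op :: "('h::real_normed_vector \<Rightarrow>\<^sub>L 'h) \<Rightarrow> ('h \<Rightarrow>\<^sub>L 'h) \<Rightarrow> ('h \<Rightarrow>\<^sub>L 'h) \<Rightarrow> 'h \<Rightarrow>\<^sub>L 'h" where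
  "T_op U W F = W o\<^sub>L F o\<^sub>L U"

definition dense_in :: "'a topology \<Rightarrow> 'a set \<Rightarrow> bool" where
  "dense_in X S \<longleftrightarrow> S \<subseteq> topspace X \<and> X closure_of S = topspace X"

text \<open>
  The space is a subset \<open>X\<close> of a type; \<open>X\<^sup>N\<close> consists of the functions on \<open>{1..N}\<close> with values
  in \<open>X\<close>, extended by \<open>undefined\<close>.
\<close>

definition d_hypercyclic_vector :: "'a::topological_space set \<Rightarrow> nat \<Rightarrow> (nat \<Rightarrow> 'a \<Rightarrow> 'a) \<Rightarrow> 'a \<Rightarrow> bool" where
  "d_hypercyclic_vector X N T x \<longleftrightarrow>
     x \<in> X \<and>
     dense_in (product_topology (\<lambda>_. top_of_set X) {1..N})
       (range (\<lambda>n. \<lambda>l\<in>{1..N}. (T l ^^ n) x))"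

lemma op_inverse_eqI:
  assumes "A o\<^sub>L B = id_blinfun" "B o\<^sub>L A = id_blinfun"
  shows "op_inverse A = B"
  unfolding op_inverse_def
proof (rule the_equality)
  fix C assume C: "A o\<^sub>L C = id_blinfun \<and> C o\<^sub>L A = id_blinfun"
  have "C = C o\<^sub>L (A o\<^sub>L B)" unfolding assms by (simp add: blinfun_eqI)
  also have "\<dots> = (C o\<^sub>L A) o\<^sub>L B" by (simp add: blinfun_eqI)
  also have "\<dots> = B" using C by (simp add: blinfun_eqI)
  finally show "C = B" .
qed (use assms in simp)

lemma cinner_zero_left [simp]: "cinner (0::'h::complex_hilbert) y = 0"
  using cinner_add_left[of 0 0 y] by simp

lemma cinner_diff_left: "cinner (x - y) z = cinner x z - cinner y (z::'h::complex_hilbert)"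
  using cinner_add_left[of "x - y" y z] by simp

lemma cinner_add_right: "cinner z (x + y) = cinner z x + cinner z (y::'h::complex_hilbert)"
  by (metis cinner_add_left cinner_commute complex_cnj_add)

lemma cinner_scaleC_right: "cinner x (c *\<^sub>C y) = cnj c * cinner x (y::'h::complex_hilbert)"
  by (metis cinner_commute cinner_scaleC_left complex_cnj_mult)

lemma cinner_sum_left: "cinner (\<Sum>i\<in>I. f i) (y::'h::complex_hilbert) = (\<Sum>i\<in>I. cinner (f i) y)"
  by (induction I rule: infinite_finite_induct) (simp_all add: cinner_add_left)

lemma norm_sq_eq_cinner: "(norm x)\<^sup>2 = Re (cinner x (x::'h::complex_hilbert))"
  by (simp flip: inner_eq_Re_cinner add: power2_norm_eq_inner)

lemma orth_proj_eqI:
  assumes "\<And>x. blinfun_apply P x \<in> M" and "\<And>x y. y \<in> M \<Longrightarrow> cinner (x - blinfun_apply P x) y = 0"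
    and M: "\<And>x y. x \<in> M \<Longrightarrow> y \<in> M \<Longrightarrow> x - y \<in> M"
  shows "orth_proj M = P"
  unfolding orth_proj_def
proof (rule the_equality)
  fix Q :: "'a \<Rightarrow>\<^sub>L 'a"
  assume Q: "\<forall>x. blinfun_apply Q x \<in> M \<and> (\<forall>y\<in>M. cinner (x - blinfun_apply Q x) y = 0)"
  show "Q = P"
  proof (rule blinfun_eqI)
    fix x
    let ?d = "blinfun_apply Q x - blinfun_apply P x"
    have dM: "?d \<in> M" using Q M assms(1) by blast
    have "cinner ?d ?d = cinner (x - blinfun_apply P x) ?d - cinner (x - blinfun_apply Q x) ?d"
      by (simp flip: cinner_diff_left)
    also have "\<dots> = 0" using dM Q assms(2) by simp
    finally have "(norm ?d)\<^sup>2 = 0" by (simp add: norm_sq_eq_cinner)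
    then show "blinfun_apply Q x = blinfun_apply P x" by simp
  qed
qed (use assms in blast)

lemma norm_scaleC: "norm (c *\<^sub>C x) = cmod c * norm (x::'h::complex_hilbert)"
proof -
  have "(norm (c *\<^sub>C x))\<^sup>2 = Re ((c * cnj c) * cinner x x)"
    by (simp add: norm_sq_eq_cinner cinner_scaleC_left cinner_scaleC_right algebra_simps)
  also have "\<dots> = (cmod c * norm x)\<^sup>2"
    by (simp add: norm_sq_eq_cinner power_mult_distrib flip: complex_norm_square of_real_power)
  finally show ?thesis
    by (simp add: power2_eq_iff_nonneg)
qed

lemma cmod_cinner_le: "cmod (cinner x y) \<le> norm x * norm (y::'h::complex_hilbert)"
proof (cases "cinner x y = 0")
  case False
  define c where "c = cnj (cinner x y) / cmod (cinner x y)"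
  have c: "cmod c = 1" using False by (simp add: c_def norm_divide)
  have "c * cinner x y = (cnj (cinner x y) * cinner x y) / cmod (cinner x y)"
    by (simp add: c_def)
  also have "\<dots> = cmod (cinner x y)"
    using False complex_norm_square[of "cinner x y"] by (simp add: mult.commute power2_eq_square field_simps)
  finally have "cmod (cinner x y) = inner (c *\<^sub>C x) y"
    by (simp add: inner_eq_Re_cinner cinner_scaleC_left)
  also have "\<dots> \<le> norm (c *\<^sub>C x) * norm y" by (rule norm_cauchy_schwarz)
  finally show ?thesis by (simp add: norm_scaleC c)
qed simp

lemma orth_proj_basis_span:
  assumes e: "orthonormal_basis e"
  shows "blinfun_apply (orth_proj (basis_span e k)) x = (\<Sum>j=1..k. cinner x (e j) *\<^sub>C e j)"
proof -
  define p where "p x = (\<Sum>j=1..k. cinner x (e j) *\<^sub>C e j)" for x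
  have on: "cinner (e i) (e j) = (if i = j then 1 else 0)" if "i \<ge> 1" "j \<ge> 1" for i j
    using e that by (simp add: orthonormal_basis_def)
  have bl: "bounded_linear p"
  proof (rule bounded_linear_intro[where K = "\<Sum>j=1..k. norm (e j) * norm (e j)"])
    show "p (x + y) = p x + p y" for x y
      by (simp add: p_def cinner_add_left scaleC_add_left sum.distrib)
    show "p (r *\<^sub>R x) = r *\<^sub>R p x" for r x
      by (simp add: p_def scaleR_right.sum cinner_scaleC_left scaleC_scaleC flip: scaleC_of_real)
        (simp add: cvec.scale_sum_right scaleC_scaleC)
    fix x
    have "norm (p x) \<le> (\<Sum>j=1..k. norm (cinner x (e j) *\<^sub>C e j))"
      unfolding p_def by (rule norm_sum)
    also have "\<dots> \<le> (\<Sum>j=1..k. norm x * (norm (e j) * norm (e j)))"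
      unfolding norm_scaleC mult.assoc[symmetric]
      by (intro sum_mono mult_right_mono cmod_cinner_le) auto
    finally show "norm (p x) \<le> norm x * (\<Sum>j=1..k. norm (e j) * norm (e j))"
      by (simp add: sum_distrib_left)
  qed
  have pe: "cinner (x - p x) (e i) = 0" if "i \<in> {1..k}" for x i
  proof -
    have "cinner (p x) (e i) = (\<Sum>j=1..k. cinner x (e j) * (if j = i then 1 else 0))"
      unfolding p_def cinner_sum_left cinner_scaleC_left using that
      by (intro sum.cong refl) (simp add: on)
    also have "\<dots> = cinner x (e i)" using that by (simp add: if_distrib cong: if_cong)
    finally show ?thesis by (simp add: cinner_diff_left)
  qed
  have "orth_proj (basis_span e k) = Blinfun p"
  proof (rule orth_proj_eqI)
    show "blinfun_apply (Blinfun p) x \<in> basis_span e k" for x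
      unfolding bounded_linear_Blinfun_apply[OF bl] p_def basis_span_def
      by (intro cvec.span_sum cvec.span_scale cvec.span_base) auto
    fix x y assume "y \<in> basis_span e k"
    then have "cinner (x - p x) y = 0"
      unfolding basis_span_def
    proof (induction rule: cvec.span_induct_alt)
      case base
      show ?case by (metis cinner_commute cinner_zero_left complex_cnj_zero)
    next
      case (step c a z)
      then show ?case using pe by (auto simp: cinner_add_right cinner_scaleC_right)
    qed
    then show "cinner (x - blinfun_apply (Blinfun p) x) y = 0"
      by (simp add: bounded_linear_Blinfun_apply[OF bl])
  qed (simp add: basis_span_def cvec.span_diff)
  then show ?thesis by (simp add: bounded_linear_Blinfun_apply[OF bl] p_def)
qed

end

theory Submission
  imports Defs
begin

text \<open>
  Write \<open>P\<^sub>m\<close> for the orthogonal projection onto \<open>L\<^sub>m\<close>. The iterates are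
  \<open>(T\<^sub>l\<^sup>r)\<^sup>n F = W\<^sub>l\<^sup>a F U\<^sup>a\<close> with \<open>r = r\<^sub>l\<close> and \<open>a = r\<^sub>l n\<close>; as \<open>U\<close> is unitary, the powers of
  \<open>U\<close> do not affect norm estimates.

  Suppose that the d-hypercyclic vectors are dense. Take such a vector \<open>F\<close> near \<open>P\<^sub>m\<close> and a large
  time \<open>n\<close> at which all iterates \<open>W\<^sub>l\<^sup>a F U\<^sup>a\<close> are near \<open>P\<^sub>m\<close>; such times exist because
  \<open>P\<^sub>m\<close> is not isolated (\<open>d_hypercyclic_orbit_near_late\<close>). The operators \<open>D = F P\<^sub>m\<close> and
  \<open>G\<^sub>l = W\<^sub>l\<^sup>a F U\<^sup>a P\<^sub>m\<close> are near \<open>P\<^sub>m\<close>. The other products that must be small all have the form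
  \<open>K U\<^sup>d P\<^sub>m\<close> with \<open>K\<close> near \<open>P\<^sub>m\<close> and \<open>d\<close> one of \<open>r\<^sub>l n\<close>, \<open>- r\<^sub>l n\<close>, \<open>(r\<^sub>s - r\<^sub>l) n\<close>. Here
  \<open>\<bar>d\<bar> \<ge> n\<close>, since the \<open>r\<^sub>l\<close> are positive and distinct, so \<open>P\<^sub>m U\<^sup>d P\<^sub>m = 0\<close> by the
  orthogonality assumption on \<open>U\<close> (\<open>compression_unitary_power_eq_0\<close>, \<open>approx_system_if_orbit_near\<close>).

  Conversely, let \<open>F\<close> and \<open>R\<^sub>1, \<dots>, R\<^sub>N\<close> be compact. As \<open>P\<^sub>m F\<close> tends to \<open>F\<close>, one may assume
  \<open>P\<^sub>m F = F\<close> and \<open>P\<^sub>m R\<^sub>l = R\<^sub>l\<close>. Given \<open>D\<close> and \<open>G\<^sub>l\<close> for this \<open>m\<close>, the operator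
  \<open>H = D F + (\<Sum>s. W\<^sub>s\<^sup>-\<^sup>a G\<^sub>s R\<^sub>s U\<^sup>-\<^sup>a)\<close>, with \<open>a = r\<^sub>s n\<close> in the summand \<open>s\<close>, is near \<open>F\<close>, and its
  \<open>l\<close>-th iterate at time \<open>n\<close> is near \<open>R\<^sub>l\<close> (\<open>transfer_estimate\<close>). So the operators are
  topologically transitive in the joint sense, and the Baire category theorem yields a dense set of
  d-hypercyclic vectors (\<open>dense_d_hypercyclic_if_transitive\<close>). This requires the compact operators to
  be complete (\<open>closed_compact_ops\<close>) and separable (\<open>compact_ops_separable\<close>).
\<close>

text \<open>
  A complex Hilbert space has the axioms of a Banach space; the class inclusion makes its operators
  a Banach space too.
\<close>
instance complex_hilbert \<subseteq> banach ..

section \<open>Dense orbits and the Baire category theorem\<close>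

lemma dense_in_top_of_set_iff:
  fixes S X :: "'a::metric_space set"
  assumes "S \<subseteq> X"
  shows "dense_in (top_of_set X) S \<longleftrightarrow> (\<forall>x\<in>X. \<forall>\<epsilon>>0. \<exists>y\<in>S. dist y x < \<epsilon>)"
proof -
  have "(top_of_set X) closure_of S = X \<inter> closure S"
    using assms by (simp add: closure_of_subtopology Int_absorb1)
  then have "dense_in (top_of_set X) S \<longleftrightarrow> X \<subseteq> closure S"
    using assms by (auto simp: dense_in_def)
  then show ?thesis
    by (auto simp: closure_approachable)
qed

lemma dense_in_product_top_of_set_iff:
  fixes f :: "'b \<Rightarrow> 'i \<Rightarrow> 'a::metric_space"
  assumes I: "finite I" and fX: "\<And>n i. i \<in> I \<Longrightarrow> f n i \<in> X"
  shows "dense_in (product_topology (\<lambda>_. top_of_set X) I) (range (\<lambda>n. restrict (f n) I)) \<longleftrightarrow>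
    (\<forall>z. (\<forall>i\<in>I. z i \<in> X) \<longrightarrow> (\<forall>\<epsilon>>0. \<exists>n. \<forall>i\<in>I. dist (f n i) (z i) < \<epsilon>))"
  (is "dense_in ?T ?S \<longleftrightarrow> ?R")
proof
  assume d: "dense_in ?T ?S"
  show ?R
  proof (intro allI impI)
    fix z and \<epsilon> :: real assume z: "\<forall>i\<in>I. z i \<in> X" and \<epsilon>: "\<epsilon> > 0"
    have "restrict z I \<in> ?T closure_of ?S"
      using d z by (auto simp: dense_in_def)
    moreover have "openin ?T (\<Pi>\<^sub>E i\<in>I. X \<inter> ball (z i) \<epsilon>)"
      using I by (simp add: openin_PiE_gen openin_open_Int)
    moreover have "restrict z I \<in> (\<Pi>\<^sub>E i\<in>I. X \<inter> ball (z i) \<epsilon>)"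
      using z \<epsilon> by auto
    ultimately obtain y where "y \<in> ?S" "y \<in> (\<Pi>\<^sub>E i\<in>I. X \<inter> ball (z i) \<epsilon>)"
      unfolding in_closure_of by blast
    then obtain n where "restrict (f n) I \<in> (\<Pi>\<^sub>E i\<in>I. X \<inter> ball (z i) \<epsilon>)" by blast
    then have "dist (f n i) (z i) < \<epsilon>" if "i \<in> I" for i
      using that by (force simp: dist_commute dest: PiE_mem)
    then show "\<exists>n. \<forall>i\<in>I. dist (f n i) (z i) < \<epsilon>" by blast
  qed
next
  assume R: ?R
  have S: "?S \<subseteq> topspace ?T" using fX by auto
  have "z \<in> ?T closure_of ?S" if z: "z \<in> topspace ?T" for z
    unfolding in_closure_of
  proof (intro conjI allI impI)
    fix V assume V: "z \<in> V \<and> openin ?T V"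
    then obtain B where B: "\<And>i. i \<in> I \<Longrightarrow> openin (top_of_set X) (B i)"
        and zB: "z \<in> Pi\<^sub>E I B" and BV: "Pi\<^sub>E I B \<subseteq> V"
      unfolding openin_product_topology_alt by meson
    have "\<exists>\<epsilon>>0. \<forall>y\<in>X. dist y (z i) < \<epsilon> \<longrightarrow> y \<in> B i" if "i \<in> I" for i
      using B[OF that] PiE_mem[OF zB that] by (auto simp: openin_euclidean_subtopology_iff)
    then obtain \<epsilon> where \<epsilon>: "\<And>i. i \<in> I \<Longrightarrow> \<epsilon> i > (0::real)"
        "\<And>i y. i \<in> I \<Longrightarrow> y \<in> X \<Longrightarrow> dist y (z i) < \<epsilon> i \<Longrightarrow> y \<in> B i"
      by metis
    define \<delta> where "\<delta> = Min (insert 1 (\<epsilon> ` I))"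
    have \<delta>: "\<delta> > 0" "\<And>i. i \<in> I \<Longrightarrow> \<delta> \<le> \<epsilon> i"
      using I \<epsilon>(1) by (auto simp: \<delta>_def)
    have "\<forall>i\<in>I. z i \<in> X" using z by auto
    then obtain n where n: "\<forall>i\<in>I. dist (f n i) (z i) < \<delta>"
      using R \<delta>(1) by blast
    have "restrict (f n) I \<in> Pi\<^sub>E I B"
      using n \<delta>(2) \<epsilon>(2) fX by (intro restrict_PiE_iff[THEN iffD2]) force
    then show "\<exists>y. y \<in> ?S \<and> y \<in> V" using BV by blast
  qed (use z in auto)
  then show "dense_in ?T ?S"
    unfolding dense_in_def using S closure_of_subset_topspace[of ?T ?S] by blast
qed

lemma d_hypercyclic_vector_iff:
  fixes T :: "nat \<Rightarrow> 'a::metric_space \<Rightarrow> 'a"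
  assumes "\<And>l x. l \<in> {1..N} \<Longrightarrow> x \<in> X \<Longrightarrow> T l x \<in> X"
  shows "d_hypercyclic_vector X N T x \<longleftrightarrow>
    x \<in> X \<and> (\<forall>z. (\<forall>l\<in>{1..N}. z l \<in> X) \<longrightarrow> (\<forall>\<epsilon>>0. \<exists>n. \<forall>l\<in>{1..N}. dist ((T l ^^ n) x) (z l) < \<epsilon>))"
proof (cases "x \<in> X")
  case True
  have "(T l ^^ n) x \<in> X" if "l \<in> {1..N}" for l n
    using True assms[OF that] by (induction n) auto
  then show ?thesis
    using True dense_in_product_top_of_set_iff[of "{1..N}" "\<lambda>n l. (T l ^^ n) x" X]
    by (simp add: d_hypercyclic_vector_def)
qed (simp add: d_hypercyclic_vector_def)

text \<open>
  A Birkhoff transitivity criterion: for a countable dense set \<open>Q\<close>, the d-hypercyclic vectors are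
  the intersection, over the targets \<open>y \<in> Q\<^sup>N\<close> and the radii \<open>1/(j+1)\<close>, of the open sets of
  points with some iterate close to \<open>y\<close>. Transitivity says that these sets are dense.
\<close>
lemma dense_d_hypercyclic_if_transitive:
  fixes T :: "nat \<Rightarrow> 'a::complete_space \<Rightarrow> 'a"
  assumes X: "closed X"
    and Q: "countable Q" "Q \<subseteq> X" "X \<subseteq> closure Q"
    and T: "\<And>l x. l \<in> {1..N} \<Longrightarrow> x \<in> X \<Longrightarrow> T l x \<in> X"
    and cont: "\<And>l. l \<in> {1..N} \<Longrightarrow> continuous_on UNIV (T l)"
    and trans: "\<And>x y \<epsilon>. x \<in> X \<Longrightarrow> (\<And>l. l \<in> {1..N} \<Longrightarrow> y l \<in> X) \<Longrightarrow> \<epsilon> > 0 \<Longrightarrow>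
      \<exists>h\<in>X. dist h x < \<epsilon> \<and> (\<exists>n. \<forall>l\<in>{1..N}. dist ((T l ^^ n) h) (y l) < \<epsilon>)"
  shows "dense_in (top_of_set X) {x. d_hypercyclic_vector X N T x}"
proof -
  define V where "V = (\<lambda>(y, j::nat). {h. \<exists>n. \<forall>l\<in>{1..N}. dist ((T l ^^ n) h) (y l) < 1 / Suc j})"
  define \<G> where "\<G> = (\<lambda>p. X \<inter> V p) ` (PiE {1..N} (\<lambda>_. Q) \<times> UNIV)"
  have cont_pow: "continuous_on UNIV (T l ^^ n)" if "l \<in> {1..N}" for l n
  proof (induction n)
    case (Suc n)
    show ?case
      using continuous_on_compose[OF Suc continuous_on_subset[OF cont[OF that] subset_UNIV]] by simp
  qed (simp add: continuous_on_id flip: id_def)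
  have "open {h. dist ((T l ^^ n) h) z < \<epsilon>}" if "l \<in> {1..N}" for l n z \<epsilon>
    by (intro open_Collect_less continuous_intros cont_pow[OF that])
  then have open_V: "open (V p)" for p
    by (cases p) (auto simp: V_def Collect_ex_eq Collect_ball_eq intro!: open_UN open_INT)
  have "(top_of_set X) closure_of \<Inter>\<G> = topspace (top_of_set X)"
  proof (rule Baire_category)
    show "completely_metrizable_space (top_of_set X) \<or>
        locally_compact_space (top_of_set X) \<and> regular_space (top_of_set X)"
      using completely_metrizable_space_closedin[OF completely_metrizable_space_euclidean
        closed_closedin[THEN iffD1, OF X]] by blast
    show "countable \<G>"
      unfolding \<G>_def using Q(1) by (intro countable_image countable_SIGMA countable_PiE) auto
    fix G assume "G \<in> \<G>"
    then obtain y j where y: "y \<in> PiE {1..N} (\<lambda>_. Q)" and G: "G = X \<inter> V (y, j)"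
      by (auto simp: \<G>_def)
    have "dense_in (top_of_set X) G"
      unfolding G
    proof (subst dense_in_top_of_set_iff, simp, intro ballI allI impI)
      fix x and \<epsilon> :: real assume x: "x \<in> X" and \<epsilon>: "\<epsilon> > 0"
      have "\<exists>h\<in>X. dist h x < min \<epsilon> (1 / Suc j) \<and>
          (\<exists>n. \<forall>l\<in>{1..N}. dist ((T l ^^ n) h) (y l) < min \<epsilon> (1 / Suc j))"
        using x y \<epsilon> Q(2) by (intro trans) auto
      then show "\<exists>h\<in>X \<inter> V (y, j). dist h x < \<epsilon>"
        by (fastforce simp: V_def)
    qed
    then show "openin (top_of_set X) G \<and> (top_of_set X) closure_of G = topspace (top_of_set X)"
      by (simp add: G open_V openin_open_Int dense_in_def)
  qed
  moreover have "X \<inter> \<Inter>\<G> \<subseteq> {x. d_hypercyclic_vector X N T x}"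
  proof
    fix h assume h: "h \<in> X \<inter> \<Inter>\<G>"
    have "\<exists>n. \<forall>l\<in>{1..N}. dist ((T l ^^ n) h) (z l) < \<epsilon>"
      if z: "\<forall>l\<in>{1..N}. z l \<in> X" and \<epsilon>: "\<epsilon> > 0" for z \<epsilon>
    proof -
      obtain j where j: "1 / real (Suc j) < \<epsilon> / 2"
        using nat_approx_posE[of "\<epsilon> / 2"] \<epsilon> by auto
      have "\<exists>y\<in>Q. dist y (z l) < \<epsilon> / 2" if "l \<in> {1..N}" for l
        using z Q(3) that half_gt_zero[OF \<epsilon>] unfolding closure_approachable subset_iff by blast
      then obtain y where y: "\<And>l. l \<in> {1..N} \<Longrightarrow> y l \<in> Q \<and> dist (y l) (z l) < \<epsilon> / 2"
        by metis
      have "h \<in> V (restrict y {1..N}, j)"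
      proof -
        have "X \<inter> V (restrict y {1..N}, j) \<in> \<G>"
          unfolding \<G>_def using y by (intro imageI SigmaI) auto
        then show ?thesis using h by blast
      qed
      then obtain n where n: "\<forall>l\<in>{1..N}. dist ((T l ^^ n) h) (y l) < 1 / Suc j"
        by (auto simp: V_def)
      have "dist ((T l ^^ n) h) (z l) < \<epsilon>" if "l \<in> {1..N}" for l
        using n[rule_format, OF that] y[OF that] j dist_triangle[of "(T l ^^ n) h" "z l" "y l"] by linarith
      then show ?thesis by blast
    qed
    then show "h \<in> {x. d_hypercyclic_vector X N T x}"
      using h by (intro CollectI iffD2[OF d_hypercyclic_vector_iff[of N X T, OF T]] conjI allI impI) auto
  qed
  moreover have "(top_of_set X) closure_of (X \<inter> \<Inter>\<G>) = (top_of_set X) closure_of \<Inter>\<G>"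
    using closure_of_restrict[of "top_of_set X" "\<Inter>\<G>"] by simp
  ultimately have "X \<subseteq> (top_of_set X) closure_of {x. d_hypercyclic_vector X N T x}"
    using closure_of_mono[of "X \<inter> \<Inter>\<G>" "{x. d_hypercyclic_vector X N T x}" "top_of_set X"] by simp
  moreover have "{x. d_hypercyclic_vector X N T x} \<subseteq> X"
    by (auto simp: d_hypercyclic_vector_def)
  ultimately show ?thesis
    using closure_of_subset_topspace[of "top_of_set X" "{x. d_hypercyclic_vector X N T x}"]
    by (simp add: dense_in_def subset_antisym)
qed

text \<open>
  Only finitely many terms of the orbit have index at most \<open>M\<close>, so the orbit comes close to
  \<open>(p, \<dots>, p)\<close> at later times as well, provided that \<open>p\<close> is not isolated: aim at a point near \<open>p\<close>
  that is none of the first coordinates of these terms.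
\<close>
lemma d_hypercyclic_orbit_near_late:
  fixes T :: "nat \<Rightarrow> 'a::metric_space \<Rightarrow> 'a"
  assumes T: "\<And>l x. l \<in> {1..N} \<Longrightarrow> x \<in> X \<Longrightarrow> T l x \<in> X" and N: "N \<ge> 1"
    and x: "d_hypercyclic_vector X N T x"
    and p: "p islimpt X" and \<epsilon>: "\<epsilon> > 0"
  shows "\<exists>n>M. \<forall>l\<in>{1..N}. dist ((T l ^^ n) x) p < \<epsilon>"
proof -
  define F where "F = (\<lambda>n. (T 1 ^^ n) x) ` {..M}"
  have F: "finite F" by (simp add: F_def)
  have "infinite (X \<inter> ball p (\<epsilon> / 2))"
    using p \<epsilon> by (simp add: islimpt_eq_infinite_ball)
  then obtain q where q: "q \<in> X" "dist p q < \<epsilon> / 2" "q \<notin> F"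
    using F by (metis IntD1 IntD2 finite_subset mem_ball subsetI)
  have "open (- F)" using F by (simp add: finite_imp_closed open_Compl)
  then obtain \<delta> where \<delta>: "\<delta> > 0" "\<And>y. dist y q < \<delta> \<Longrightarrow> y \<notin> F"
    using q(3) by (metis Compl_iff open_dist)
  have orbit: "\<forall>z. (\<forall>l\<in>{1..N}. z l \<in> X) \<longrightarrow> (\<forall>\<epsilon>>0. \<exists>n. \<forall>l\<in>{1..N}. dist ((T l ^^ n) x) (z l) < \<epsilon>)"
    using iffD1[OF d_hypercyclic_vector_iff[of N X T, OF T] x] by (rule conjunct2)
  have "\<exists>n. \<forall>l\<in>{1..N}. dist ((T l ^^ n) x) q < min \<delta> (\<epsilon> / 2)"
    using q(1) \<delta>(1) \<epsilon> by (intro orbit[rule_format, of "\<lambda>_. q" "min \<delta> (\<epsilon> / 2)"]) auto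
  then obtain n where n: "\<And>l. l \<in> {1..N} \<Longrightarrow> dist ((T l ^^ n) x) q < min \<delta> (\<epsilon> / 2)"
    by blast
  have "(T 1 ^^ n) x \<notin> F" using n[of 1] N \<delta>(2) by simp
  then have "n > M" by (auto simp: F_def)
  moreover have "dist ((T l ^^ n) x) p < \<epsilon>" if "l \<in> {1..N}" for l
    using n[OF that] q(2) dist_triangle[of "(T l ^^ n) x" p q] by (simp add: dist_commute)
  ultimately show ?thesis by blast
qed

section \<open>Bounded and compact operators\<close>

text \<open>
  Composition \<open>o\<^sub>L\<close> binds more weakly than \<open>+\<close> and \<open>-\<close>, so products in sums need parentheses.
\<close>

lemma blinfun_compose_assoc: "(A o\<^sub>L B) o\<^sub>L C = A o\<^sub>L (B o\<^sub>L C)"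
  by (rule blinfun_eqI) simp

lemma blinfun_compose_id [simp]: "id_blinfun o\<^sub>L A = A" "A o\<^sub>L id_blinfun = A"
  by (rule blinfun_eqI, simp)+

lemmas blinfun_compose_distribs =
  bounded_bilinear.add_left[OF bounded_bilinear_blinfun_compose]
  bounded_bilinear.add_right[OF bounded_bilinear_blinfun_compose]
  bounded_bilinear.diff_left[OF bounded_bilinear_blinfun_compose]
  bounded_bilinear.diff_right[OF bounded_bilinear_blinfun_compose]
  bounded_bilinear.sum_left[OF bounded_bilinear_blinfun_compose]
  bounded_bilinear.sum_right[OF bounded_bilinear_blinfun_compose]

lemma norm_blinfun_compose_le:
  assumes "norm A \<le> a" "norm B \<le> b"
  shows "norm (A o\<^sub>L B) \<le> a * b"
  using norm_blinfun_compose[of A B] mult_mono[OF assms order_trans[OF norm_ge_zero assms(1)] norm_ge_zero]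
  by linarith

lemma op_power_0 [simp]: "op_power A 0 = id_blinfun"
  by (simp add: op_power_def)

lemma op_power_Suc: "op_power A (Suc n) = A o\<^sub>L op_power A n"
  by (simp add: op_power_def)

lemma op_power_add: "op_power A (m + n) = op_power A m o\<^sub>L op_power A n"
  by (induction m) (simp_all add: op_power_Suc blinfun_compose_assoc)

lemma op_power_Suc': "op_power A (Suc n) = op_power A n o\<^sub>L A"
  using op_power_add[of A n 1] by (simp add: op_power_Suc)

lemma op_power_inverse:
  assumes "A o\<^sub>L B = id_blinfun"
  shows "op_power A n o\<^sub>L op_power B n = id_blinfun"
proof (induction n)
  case (Suc n)
  have "op_power A (Suc n) o\<^sub>L op_power B (Suc n) = op_power A n o\<^sub>L (A o\<^sub>L B) o\<^sub>L op_power B n"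
    by (simp only: op_power_Suc'[of A] op_power_Suc[of B] blinfun_compose_assoc)
  then show ?case by (simp add: assms Suc)
qed simp

lemma T_op_power: "(T_op U W ^^ n) F = op_power W n o\<^sub>L F o\<^sub>L op_power U n"
proof (induction n)
  case (Suc n)
  then show ?case
    by (simp only: funpow.simps comp_apply T_op_def op_power_Suc[of W] op_power_Suc'[of U] blinfun_compose_assoc)
qed simp

lemma T_op_power_power: "((T_op U W ^^ r) ^^ n) F = op_power W (r * n) o\<^sub>L F o\<^sub>L op_power U (r * n)"
  by (simp add: funpow_mult mult.commute T_op_power)

lemma bounded_opsD: "A \<in> bounded_ops \<Longrightarrow> blinfun_apply A (c *\<^sub>C x) = c *\<^sub>C blinfun_apply A x"
  by (simp add: bounded_ops_def)

lemma id_in_bounded_ops [simp]: "id_blinfun \<in> bounded_ops"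
  by (simp add: bounded_ops_def)

lemma compose_in_bounded_ops: "A \<in> bounded_ops \<Longrightarrow> B \<in> bounded_ops \<Longrightarrow> A o\<^sub>L B \<in> bounded_ops"
  by (simp add: bounded_ops_def)

lemma op_power_in_bounded_ops: "A \<in> bounded_ops \<Longrightarrow> op_power A n \<in> bounded_ops"
  by (induction n) (simp_all add: op_power_Suc compose_in_bounded_ops)

lemma add_in_bounded_ops: "A \<in> bounded_ops \<Longrightarrow> B \<in> bounded_ops \<Longrightarrow> A + B \<in> bounded_ops"
  by (simp add: bounded_ops_def blinfun.add_left scaleC_add_right)

lemma scaleR_scaleC_commute: "a *\<^sub>R c *\<^sub>C x = c *\<^sub>C a *\<^sub>R (x::'h::complex_hilbert)"
  by (simp add: scaleC_scaleC mult.commute flip: scaleC_of_real)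

lemma scaleR_in_bounded_ops: "A \<in> bounded_ops \<Longrightarrow> a *\<^sub>R A \<in> bounded_ops"
  by (simp add: bounded_ops_def blinfun.scaleR_left scaleR_scaleC_commute)

lemma bounded_linear_scaleC_right: "bounded_linear (\<lambda>x::'h::complex_hilbert. c *\<^sub>C x)"
  by (rule bounded_linear_intro[where K = "cmod c"])
     (simp_all add: scaleC_add_right scaleR_scaleC_commute norm_scaleC)

lemma bounded_linear_scaleC_left: "bounded_linear (\<lambda>c. c *\<^sub>C (x::'h::complex_hilbert))"
  by (rule bounded_linear_intro[where K = "norm x"])
     (simp_all add: scaleC_add_left norm_scaleC scaleC_scaleC scaleR_conv_of_real flip: scaleC_of_real)

lemma bounded_linear_cinner_left: "bounded_linear (\<lambda>x::'h::complex_hilbert. cinner x y)"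
  by (rule bounded_linear_intro[where K = "norm y"])
     (simp_all add: cinner_add_left cinner_scaleC_left scaleR_conv_of_real cmod_cinner_le flip: scaleC_of_real)

lemma closed_bounded_ops: "closed (bounded_ops :: ('h::complex_hilbert \<Rightarrow>\<^sub>L 'h) set)"
proof -
  have "closed {A :: 'h \<Rightarrow>\<^sub>L 'h. blinfun_apply A (c *\<^sub>C x) = c *\<^sub>C blinfun_apply A x}" for c x
    by (intro closed_Collect_eq bounded_linear.continuous_on[OF bounded_linear_scaleC_right]
        continuous_intros)
  then show ?thesis
    by (simp add: bounded_ops_def Collect_all_eq closed_INT)
qed

lemma op_inverse:
  assumes "invertible_op A"
  shows "op_inverse A \<in> bounded_ops" "A o\<^sub>L op_inverse A = id_blinfun" "op_inverse A o\<^sub>L A = id_blinfun"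
proof -
  obtain B where B: "B \<in> bounded_ops" "A o\<^sub>L B = id_blinfun" "B o\<^sub>L A = id_blinfun"
    using assms by (auto simp: invertible_op_def)
  moreover have "op_inverse A = B" using B(2,3) by (rule op_inverse_eqI)
  ultimately show "op_inverse A \<in> bounded_ops" "A o\<^sub>L op_inverse A = id_blinfun" "op_inverse A o\<^sub>L A = id_blinfun"
    by simp_all
qed

lemma compact_opsI:
  assumes "A \<in> bounded_ops" "compact K" "blinfun_apply A ` cball 0 1 \<subseteq> K"
  shows "A \<in> compact_ops"
proof -
  have "closure (blinfun_apply A ` cball 0 1) \<subseteq> K"
    using assms(2,3) by (intro closure_minimal compact_imp_closed)
  then have "compact (closure (blinfun_apply A ` cball 0 1))"
    using compact_Int_closed[OF assms(2) closed_closure] by (metis inf.absorb2)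
  then show ?thesis using assms(1) by (simp add: compact_ops_def)
qed

lemma compact_opsE:
  assumes "A \<in> compact_ops"
  obtains K where "A \<in> bounded_ops" "compact K" "blinfun_apply A ` cball 0 1 \<subseteq> K"
  using assms that[OF _ _ closure_subset] by (auto simp: compact_ops_def)

lemma compact_ops_subset: "compact_ops \<subseteq> bounded_ops"
  by (auto simp: compact_ops_def)

lemma add_in_compact_ops:
  assumes "A \<in> compact_ops" "B \<in> compact_ops"
  shows "A + B \<in> compact_ops"
proof -
  obtain K where K: "A \<in> bounded_ops" "compact K" "blinfun_apply A ` cball 0 1 \<subseteq> K"
    using assms(1) by (rule compact_opsE)
  obtain L where L: "B \<in> bounded_ops" "compact L" "blinfun_apply B ` cball 0 1 \<subseteq> L"
    using assms(2) by (rule compact_opsE)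
  show ?thesis
  proof (rule compact_opsI)
    show "compact {x + y | x y. x \<in> K \<and> y \<in> L}"
      using K(2) L(2) by (rule compact_sums)
    show "blinfun_apply (A + B) ` cball 0 1 \<subseteq> {x + y | x y. x \<in> K \<and> y \<in> L}"
      using K(3) L(3) by (fastforce simp: blinfun.add_left)
  qed (simp add: add_in_bounded_ops K L)
qed

lemma compose_left_in_compact_ops:
  assumes "B \<in> bounded_ops" "A \<in> compact_ops"
  shows "B o\<^sub>L A \<in> compact_ops"
proof -
  obtain K where K: "A \<in> bounded_ops" "compact K" "blinfun_apply A ` cball 0 1 \<subseteq> K"
    using assms(2) by (rule compact_opsE)
  show ?thesis
  proof (rule compact_opsI)
    show "compact (blinfun_apply B ` K)"
      using K(2) by (intro compact_continuous_image continuous_intros)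
    show "blinfun_apply (B o\<^sub>L A) ` cball 0 1 \<subseteq> blinfun_apply B ` K"
      using K(3) by auto
  qed (simp add: compose_in_bounded_ops assms K)
qed

lemma compose_right_in_compact_ops:
  assumes "A \<in> compact_ops" "B \<in> bounded_ops"
  shows "A o\<^sub>L B \<in> compact_ops"
proof -
  obtain K where K: "A \<in> bounded_ops" "compact K" "blinfun_apply A ` cball 0 1 \<subseteq> K"
    using assms(1) by (rule compact_opsE)
  define b where "b = norm B + 1"
  have b: "b > 0" by (simp add: b_def add_nonneg_pos)
  show ?thesis
  proof (rule compact_opsI)
    show "compact ((*\<^sub>R) b ` K)"
      using K(2) by (rule compact_scaling)
    show "blinfun_apply (A o\<^sub>L B) ` cball 0 1 \<subseteq> (*\<^sub>R) b ` K"
    proof clarify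
      fix x :: 'a assume x: "x \<in> cball 0 1"
      have "norm (blinfun_apply B x) \<le> norm B * 1"
        using norm_blinfun[of B x] mult_left_mono[of "norm x" 1 "norm B"] x by simp
      then have "norm (inverse b *\<^sub>R blinfun_apply B x) \<le> 1"
        using b by (simp add: b_def field_simps)
      then have "blinfun_apply A (inverse b *\<^sub>R blinfun_apply B x) \<in> K"
        using K(3) by (simp add: image_subset_iff)
      moreover have "blinfun_apply (A o\<^sub>L B) x = b *\<^sub>R blinfun_apply A (inverse b *\<^sub>R blinfun_apply B x)"
        using b by (simp add: blinfun.scaleR_right)
      ultimately show "blinfun_apply (A o\<^sub>L B) x \<in> (*\<^sub>R) b ` K" by blast
    qed
  qed (simp add: compose_in_bounded_ops assms K)
qed

lemma zero_in_compact_ops: "0 \<in> compact_ops"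
  by (rule compact_opsI[of _ "{0}"]) (auto simp: bounded_ops_def)

lemma scaleR_in_compact_ops:
  assumes "A \<in> compact_ops"
  shows "a *\<^sub>R A \<in> compact_ops"
proof -
  have "a *\<^sub>R A = (a *\<^sub>R id_blinfun) o\<^sub>L A"
    by (rule blinfun_eqI) (simp add: blinfun.scaleR_left)
  then show ?thesis
    using compose_left_in_compact_ops[OF scaleR_in_bounded_ops[OF id_in_bounded_ops] assms] by simp
qed

lemma subspace_compact_ops: "subspace compact_ops"
  by (simp add: subspace_def zero_in_compact_ops add_in_compact_ops scaleR_in_compact_ops)

lemma compact_closure_iff_totally_bounded:
  fixes S :: "'a::complete_space set"
  shows "compact (closure S) \<longleftrightarrow> (\<forall>\<epsilon>>0. \<exists>F. finite F \<and> S \<subseteq> (\<Union>x\<in>F. ball x \<epsilon>))"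
proof
  assume "compact (closure S)"
  then show "\<forall>\<epsilon>>0. \<exists>F. finite F \<and> S \<subseteq> (\<Union>x\<in>F. ball x \<epsilon>)"
    unfolding compact_eq_totally_bounded by (meson closure_subset subset_trans)
next
  assume R: "\<forall>\<epsilon>>0. \<exists>F. finite F \<and> S \<subseteq> (\<Union>x\<in>F. ball x \<epsilon>)"
  have "\<exists>F. finite F \<and> closure S \<subseteq> (\<Union>x\<in>F. ball x \<epsilon>)" if \<epsilon>: "\<epsilon> > 0" for \<epsilon>
  proof -
    obtain F where F: "finite F" "S \<subseteq> (\<Union>x\<in>F. ball x (\<epsilon> / 2))"
      using R \<epsilon> half_gt_zero by blast
    have "closure S \<subseteq> (\<Union>x\<in>F. cball x (\<epsilon> / 2))"
    proof (intro closure_minimal closed_UN ballI closed_cball)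
      show "S \<subseteq> (\<Union>x\<in>F. cball x (\<epsilon> / 2))"
        using F(2) ball_subset_cball by (meson UN_mono order_refl subset_trans)
    qed (rule F(1))
    also have "\<dots> \<subseteq> (\<Union>x\<in>F. ball x \<epsilon>)" using \<epsilon> by force
    finally show ?thesis using F(1) by blast
  qed
  then show "compact (closure S)"
    unfolding compact_eq_totally_bounded by (simp add: complete_eq_closed)
qed

lemma closed_compact_ops: "closed (compact_ops :: ('h::complex_hilbert \<Rightarrow>\<^sub>L 'h) set)"
proof -
  have "A \<in> compact_ops" if A: "A \<in> closure compact_ops" for A :: "'h \<Rightarrow>\<^sub>L 'h"
  proof -
    have "A \<in> bounded_ops"
      using A closure_minimal[OF compact_ops_subset closed_bounded_ops] by blast
    moreover have "\<exists>F. finite F \<and> blinfun_apply A ` cball 0 1 \<subseteq> (\<Union>x\<in>F. ball x \<epsilon>)" if \<epsilon>: "\<epsilon> > 0" for \<epsilon>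
    proof -
      obtain B where B: "B \<in> compact_ops" "dist B A < \<epsilon> / 2"
        using A \<epsilon> unfolding closure_approachable by (meson half_gt_zero)
      obtain F where F: "finite F" "blinfun_apply B ` cball 0 1 \<subseteq> (\<Union>x\<in>F. ball x (\<epsilon> / 2))"
        using B(1) half_gt_zero[OF \<epsilon>] unfolding compact_ops_def compact_closure_iff_totally_bounded by blast
      have "blinfun_apply A x \<in> (\<Union>z\<in>F. ball z \<epsilon>)" if x: "x \<in> cball 0 1" for x
      proof -
        obtain z where z: "z \<in> F" "dist z (blinfun_apply B x) < \<epsilon> / 2"
          using F(2) x by (force simp: image_subset_iff)
        have "dist (blinfun_apply B x) (blinfun_apply A x) \<le> norm (B - A) * norm x"
          using norm_blinfun[of "B - A" x] by (simp add: dist_norm blinfun.diff_left)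
        also have "\<dots> \<le> norm (B - A) * 1"
          using x by (intro mult_left_mono) auto
        finally have "dist z (blinfun_apply A x) < \<epsilon>"
          using B(2) z(2) dist_triangle[of z "blinfun_apply A x" "blinfun_apply B x"]
          by (simp add: dist_norm)
        then show ?thesis using z(1) by auto
      qed
      then show ?thesis using F(1) by blast
    qed
    ultimately show ?thesis
      by (simp add: compact_ops_def compact_closure_iff_totally_bounded)
  qed
  then show ?thesis by (metis closure_subset_eq subsetI)
qed

text \<open>
  The rank-one operator \<open>x \<mapsto> \<langle>x, u\<rangle> v\<close>. It is complex linear in \<open>v\<close> and antilinear in \<open>u\<close>, hence
  real bilinear in the pair.
\<close>

definition rank_one :: "'h::complex_hilbert \<Rightarrow> 'h \<Rightarrow> 'h \<Rightarrow>\<^sub>L 'h" where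
  "rank_one u v = Blinfun (\<lambda>x. cinner x u *\<^sub>C v)"

lemma rank_one_apply [simp]: "blinfun_apply (rank_one u v) x = cinner x u *\<^sub>C v"
proof -
  have "bounded_linear (\<lambda>x. cinner x u *\<^sub>C v)"
    by (rule bounded_linear_compose[OF bounded_linear_scaleC_left bounded_linear_cinner_left])
  then show ?thesis by (simp add: rank_one_def bounded_linear_Blinfun_apply)
qed

lemma rank_one_in_compact_ops: "rank_one u v \<in> compact_ops"
proof (rule compact_opsI)
  show "rank_one u v \<in> bounded_ops"
    by (simp add: bounded_ops_def cinner_scaleC_left scaleC_scaleC)
  show "compact ((\<lambda>c. c *\<^sub>C v) ` cball 0 (norm u))"
    by (intro compact_continuous_image bounded_linear.continuous_on[OF bounded_linear_scaleC_left]
        continuous_intros) auto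
  show "blinfun_apply (rank_one u v) ` cball 0 1 \<subseteq> (\<lambda>c. c *\<^sub>C v) ` cball 0 (norm u)"
  proof clarsimp
    fix x :: 'a assume "norm x \<le> 1"
    then have "cmod (cinner x u) \<le> norm u"
      using cmod_cinner_le[of x u] mult_right_mono[of "norm x" 1 "norm u"] by simp
    then show "cinner x u *\<^sub>C v \<in> (\<lambda>c. c *\<^sub>C v) ` cball 0 (norm u)"
      by (intro imageI) simp
  qed
qed

section \<open>Orthogonal projections onto the spans of the basis\<close>

lemma cinner_zero_right [simp]: "cinner x (0::'h::complex_hilbert) = 0"
  by (metis cinner_commute cinner_zero_left complex_cnj_zero)

lemma cinner_sum_right: "cinner y (\<Sum>i\<in>I. f i) = (\<Sum>i\<in>I. cinner y (f i :: 'h::complex_hilbert))"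
  by (induction I rule: infinite_finite_induct) (simp_all add: cinner_add_right)

lemma bounded_linear_cinner_right: "bounded_linear (\<lambda>y::'h::complex_hilbert. cinner x y)"
  using bounded_linear_compose[OF bounded_linear_cnj bounded_linear_cinner_left]
  by (simp flip: cinner_commute)

lemma rank_one_linear:
  "rank_one (u + u') v = rank_one u v + rank_one u' v"
  "rank_one u (v + v') = rank_one u v + rank_one u v'"
  "rank_one (c *\<^sub>C u) v = rank_one u (cnj c *\<^sub>C v)"
  "rank_one 0 v = 0"
  "rank_one u 0 = 0"
  by (rule blinfun_eqI; simp add: blinfun.add_left cinner_add_right scaleC_add_left scaleC_add_right
      cinner_scaleC_right scaleC_scaleC mult.commute)+

lemma norm_rank_one_le: "norm (rank_one u v) \<le> norm u * norm v"
proof (rule norm_blinfun_bound)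
  fix x
  show "norm (blinfun_apply (rank_one u v) x) \<le> norm u * norm v * norm x"
    using mult_right_mono[OF cmod_cinner_le[of x u] norm_ge_zero[of v]]
    by (simp add: norm_scaleC mult_ac)
qed simp

lemma scaleC_real_combination: "c *\<^sub>C x = Re c *\<^sub>R x + Im c *\<^sub>R \<i> *\<^sub>C (x::'h::complex_hilbert)"
proof -
  have "c *\<^sub>C x = (complex_of_real (Re c) + complex_of_real (Im c) * \<i>) *\<^sub>C x"
    by (simp add: complex_eq[symmetric] mult.commute)
  then show ?thesis
    by (simp only: scaleC_add_left scaleC_scaleC[symmetric] scaleC_of_real)
qed

lemma bounded_bilinear_rank_one: "bounded_bilinear (rank_one :: 'h::complex_hilbert \<Rightarrow> 'h \<Rightarrow> _)"
proof
  fix a :: real and u v :: 'h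
  have *: "rank_one (complex_of_real a *\<^sub>C u) v = rank_one u (complex_of_real a *\<^sub>C v)"
    by (simp add: rank_one_linear(3))
  show r: "rank_one u (a *\<^sub>R v) = a *\<^sub>R rank_one u v"
    by (rule blinfun_eqI) (simp add: blinfun.scaleR_left scaleR_scaleC_commute)
  show "rank_one (a *\<^sub>R u) v = a *\<^sub>R rank_one u v"
    using * by (simp add: scaleC_of_real r)
  show "\<exists>K. \<forall>u v :: 'h. norm (rank_one u v) \<le> norm u * norm v * K"
    by (intro exI[of _ 1]) (simp add: norm_rank_one_le)
qed (simp_all add: rank_one_linear)

context
  fixes e :: "nat \<Rightarrow> 'h::complex_hilbert"
  assumes e: "orthonormal_basis e"
begin

lemma cinner_basis: "i \<ge> 1 \<Longrightarrow> j \<ge> 1 \<Longrightarrow> cinner (e i) (e j) = (if i = j then 1 else 0)"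
  using e by (simp add: orthonormal_basis_def)

lemmas proj_apply = orth_proj_basis_span[OF e]

lemma proj_eq_sum_rank_one: "orth_proj (basis_span e k) = (\<Sum>j=1..k. rank_one (e j) (e j))"
  by (rule blinfun_eqI) (simp add: proj_apply blinfun.sum_left)

lemma proj_in_compact_ops: "orth_proj (basis_span e k) \<in> compact_ops"
  unfolding proj_eq_sum_rank_one
  by (intro subspace_sum[OF subspace_compact_ops] rank_one_in_compact_ops)

lemma proj_in_bounded_ops: "orth_proj (basis_span e k) \<in> bounded_ops"
  using proj_in_compact_ops compact_ops_subset by blast

lemma proj_in_span: "blinfun_apply (orth_proj (basis_span e k)) x \<in> basis_span e k"
  unfolding proj_apply unfolding basis_span_def
  by (intro cvec.span_sum cvec.span_scale cvec.span_base) auto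

lemma cinner_proj_basis:
  assumes "i \<in> {1..k}"
  shows "cinner (blinfun_apply (orth_proj (basis_span e k)) x) (e i) = cinner x (e i)"
proof -
  have "cinner (blinfun_apply (orth_proj (basis_span e k)) x) (e i)
      = (\<Sum>j=1..k. cinner x (e j) * (if j = i then 1 else 0))"
    unfolding proj_apply cinner_sum_left cinner_scaleC_left using assms
    by (intro sum.cong refl) (simp add: cinner_basis)
  also have "\<dots> = cinner x (e i)" using assms by (simp add: if_distrib cong: if_cong)
  finally show ?thesis .
qed

lemma cinner_diff_proj:
  assumes "y \<in> basis_span e k"
  shows "cinner (x - blinfun_apply (orth_proj (basis_span e k)) x) y = 0"
  using assms unfolding basis_span_def
proof (induction rule: cvec.span_induct_alt)
  case base
  show ?case by simp
next
  case (step c a z)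
  then obtain i where "i \<in> {1..k}" "a = e i" by auto
  then show ?case
    using step cinner_proj_basis[of i k x]
    by (simp add: cinner_add_right cinner_scaleC_right cinner_diff_left basis_span_def)
qed

lemma proj_eq_0:
  assumes "\<And>y. y \<in> basis_span e k \<Longrightarrow> cinner x y = 0"
  shows "blinfun_apply (orth_proj (basis_span e k)) x = 0"
  unfolding proj_apply
proof (rule sum.neutral, rule ballI)
  fix j assume "j \<in> {1..k}"
  then have "e j \<in> basis_span e k" unfolding basis_span_def by (intro cvec.span_base) auto
  then show "cinner x (e j) *\<^sub>C e j = 0" using assms by simp
qed

lemma proj_fixes_span:
  assumes "x \<in> basis_span e k"
  shows "blinfun_apply (orth_proj (basis_span e k)) x = x"
proof -
  let ?d = "x - blinfun_apply (orth_proj (basis_span e k)) x"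
  have "?d \<in> basis_span e k"
    using assms proj_in_span[of k x] unfolding basis_span_def by (rule cvec.span_diff)
  then have "(norm ?d)\<^sup>2 = 0" by (simp add: norm_sq_eq_cinner cinner_diff_proj)
  then show ?thesis by simp
qed

lemma proj_idem: "orth_proj (basis_span e k) o\<^sub>L orth_proj (basis_span e k) = orth_proj (basis_span e k)"
  by (rule blinfun_eqI) (simp add: proj_fixes_span proj_in_span)

lemma norm_diff_proj_sq:
  "(norm (x - blinfun_apply (orth_proj (basis_span e k)) x))\<^sup>2
    = (norm x)\<^sup>2 - (norm (blinfun_apply (orth_proj (basis_span e k)) x))\<^sup>2"
proof -
  let ?p = "blinfun_apply (orth_proj (basis_span e k)) x"
  have "cinner (x - ?p) ?p = 0" by (rule cinner_diff_proj[OF proj_in_span])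
  then have "inner (x - ?p) ?p = 0" by (simp add: inner_eq_Re_cinner)
  then show ?thesis
    by (simp add: power2_norm_eq_inner inner_diff_left inner_diff_right inner_commute)
qed

lemma norm_proj_apply_le: "norm (blinfun_apply (orth_proj (basis_span e k)) x) \<le> norm x"
proof (rule power2_le_imp_le)
  show "(norm (blinfun_apply (orth_proj (basis_span e k)) x))\<^sup>2 \<le> (norm x)\<^sup>2"
    using norm_diff_proj_sq[of x k] zero_le_power2[of "norm (x - blinfun_apply (orth_proj (basis_span e k)) x)"]
    by linarith
qed (rule norm_ge_zero)

lemma norm_proj_le: "norm (orth_proj (basis_span e k)) \<le> 1"
  by (rule norm_blinfun_bound) (simp_all add: norm_proj_apply_le)

lemma basis_span_mono: "j \<le> k \<Longrightarrow> basis_span e j \<subseteq> basis_span e k"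
  unfolding basis_span_def by (intro cvec.span_mono image_mono) auto

lemma span_basis_eq_Union: "cvec.span (e ` {1..}) = (\<Union>k. basis_span e k)"
proof
  show "(\<Union>k. basis_span e k) \<subseteq> cvec.span (e ` {1..})"
    unfolding basis_span_def by (intro UN_least cvec.span_mono image_mono) auto
  show "cvec.span (e ` {1..}) \<subseteq> (\<Union>k. basis_span e k)"
  proof
    fix x assume "x \<in> cvec.span (e ` {1..})"
    then show "x \<in> (\<Union>k. basis_span e k)"
    proof (induction rule: cvec.span_induct_alt)
      case base
      show ?case using cvec.span_zero unfolding basis_span_def by blast
    next
      case (step c a y)
      then obtain i k where i: "i \<ge> 1" "a = e i" and y: "y \<in> basis_span e k" by auto
      have "a \<in> basis_span e (max i k)"
        unfolding basis_span_def using i by (intro cvec.span_base) auto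
      moreover have "y \<in> basis_span e (max i k)" using y basis_span_mono[of k "max i k"] by auto
      ultimately have "c *\<^sub>C a + y \<in> basis_span e (max i k)"
        unfolding basis_span_def by (intro cvec.span_add cvec.span_scale)
      then show ?case by blast
    qed
  qed
qed

lemma proj_tendsto: "(\<lambda>m. blinfun_apply (orth_proj (basis_span e m)) x) \<longlonglongrightarrow> x"
proof (rule metric_LIMSEQ_I)
  fix \<epsilon> :: real assume \<epsilon>: "\<epsilon> > 0"
  have "x \<in> closure (\<Union>k. basis_span e k)"
    using e span_basis_eq_Union by (simp add: orthonormal_basis_def)
  then obtain y k where y: "y \<in> basis_span e k" "dist y x < \<epsilon> / 2"
    using \<epsilon> unfolding closure_approachable by (meson UN_E half_gt_zero)
  show "\<exists>M. \<forall>m\<ge>M. dist (blinfun_apply (orth_proj (basis_span e m)) x) x < \<epsilon>"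
  proof (intro exI allI impI)
    fix m assume "m \<ge> k"
    then have "blinfun_apply (orth_proj (basis_span e m)) y = y"
      using y(1) basis_span_mono by (intro proj_fixes_span) auto
    then have "dist (blinfun_apply (orth_proj (basis_span e m)) x) y \<le> dist x y"
      using norm_proj_apply_le[of m "x - y"] by (simp add: dist_norm blinfun.diff_right)
    then show "dist (blinfun_apply (orth_proj (basis_span e m)) x) x < \<epsilon>"
      using y(2) dist_triangle[of "blinfun_apply (orth_proj (basis_span e m)) x" x y]
      by (simp add: dist_commute)
  qed
qed

text \<open>
  The projections are uniformly bounded and converge pointwise to the identity, so they converge
  uniformly on the relatively compact image of the unit ball under a compact operator.
\<close>
lemma proj_compose_tendsto:
  assumes A: "A \<in> compact_ops"
  shows "(\<lambda>m. orth_proj (basis_span e m) o\<^sub>L A) \<longlonglongrightarrow> A"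
proof (rule metric_LIMSEQ_I)
  fix \<epsilon> :: real assume \<epsilon>: "\<epsilon> > 0"
  define P where "P m = orth_proj (basis_span e m)" for m
  have "compact (closure (blinfun_apply A ` cball 0 1))"
    using A by (simp add: compact_ops_def)
  moreover have "\<epsilon> / 6 > 0" using \<epsilon> by simp
  ultimately obtain F where F: "finite F" "blinfun_apply A ` cball 0 1 \<subseteq> (\<Union>z\<in>F. ball z (\<epsilon> / 6))"
    unfolding compact_closure_iff_totally_bounded by meson
  have "\<forall>\<^sub>F m in sequentially. dist (blinfun_apply (P m) z) z < \<epsilon> / 6" for z
    unfolding P_def using \<epsilon> by (intro tendstoD[OF proj_tendsto]) simp
  then have "\<forall>\<^sub>F m in sequentially. \<forall>z\<in>F. dist (blinfun_apply (P m) z) z < \<epsilon> / 6"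
    using F(1) by (intro eventually_ball_finite) auto
  then obtain M where M: "\<And>m z. m \<ge> M \<Longrightarrow> z \<in> F \<Longrightarrow> dist (blinfun_apply (P m) z) z < \<epsilon> / 6"
    by (auto simp: eventually_sequentially)
  have "norm ((P m o\<^sub>L A) - A) \<le> \<epsilon> / 2" if m: "m \<ge> M" for m
  proof (rule norm_blinfun_bound)
    fix x :: 'h
    have unit: "norm (blinfun_apply (P m) (blinfun_apply A y) - blinfun_apply A y) \<le> \<epsilon> / 2"
      if y: "norm y \<le> 1" for y
    proof -
      obtain z where z: "z \<in> F" "dist z (blinfun_apply A y) < \<epsilon> / 6"
        using F(2) y by (force simp: image_subset_iff)
      have "dist (blinfun_apply (P m) (blinfun_apply A y)) (blinfun_apply (P m) z)
          \<le> dist (blinfun_apply A y) z"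
        using norm_proj_apply_le[of m "blinfun_apply A y - z"]
        by (simp add: dist_norm blinfun.diff_right P_def)
      then have "dist (blinfun_apply (P m) (blinfun_apply A y)) (blinfun_apply A y) \<le> \<epsilon> / 2"
        using M[OF m z(1)] z(2)
          dist_triangle[of "blinfun_apply (P m) (blinfun_apply A y)" "blinfun_apply A y" z]
          dist_triangle[of "blinfun_apply (P m) (blinfun_apply A y)" z "blinfun_apply (P m) z"]
        by (simp add: dist_commute)
      then show ?thesis by (simp add: dist_norm)
    qed
    show "norm (blinfun_apply ((P m o\<^sub>L A) - A) x) \<le> \<epsilon> / 2 * norm x"
    proof (cases "x = 0")
      case False
      define y where "y = inverse (norm x) *\<^sub>R x"
      have y: "norm y = 1" "x = norm x *\<^sub>R y" using False by (simp_all add: y_def)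
      have "norm (blinfun_apply ((P m o\<^sub>L A) - A) y) \<le> \<epsilon> / 2"
        using unit[of y] y(1) by (simp add: blinfun.diff_left)
      then have "norm x * norm (blinfun_apply ((P m o\<^sub>L A) - A) y) \<le> norm x * (\<epsilon> / 2)"
        by (rule mult_left_mono) simp
      moreover have "blinfun_apply ((P m o\<^sub>L A) - A) x = norm x *\<^sub>R blinfun_apply ((P m o\<^sub>L A) - A) y"
        by (subst y(2)) (rule blinfun.scaleR_right)
      ultimately show ?thesis by (simp add: mult.commute)
    qed simp
  qed (use \<epsilon> in simp)
  then have "dist (P m o\<^sub>L A) A < \<epsilon>" if "m \<ge> M" for m
    using that \<epsilon> by (smt (verit) dist_norm field_sum_of_halves)
  then show "\<exists>M. \<forall>m\<ge>M. dist (orth_proj (basis_span e m) o\<^sub>L A) A < \<epsilon>"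
    unfolding P_def by blast
qed

text \<open>
  The Riesz representation theorem for the functional \<open>f = \<langle>A \<cdot>, v\<rangle>\<close>: the representing vector is
  the limit of \<open>y k = (\<Sum>j=1..k. cnj (f (e j)) *\<^sub>C e j)\<close>. As \<open>f (y k) = \<parallel>y k\<parallel>\<^sup>2\<close>, the norms
  are bounded; they increase because \<open>y m\<close> is the projection of \<open>y k\<close>, and so \<open>y\<close> is Cauchy.
\<close>
lemma adjoint_vector_exists:
  fixes A :: "'h \<Rightarrow>\<^sub>L 'h"
  assumes A: "A \<in> bounded_ops"
  shows "\<exists>u. \<forall>x. cinner (blinfun_apply A x) v = cinner x u"
proof -
  define f where "f x = cinner (blinfun_apply A x) v" for x
  define P where "P m = blinfun_apply (orth_proj (basis_span e m))" for m
  define y where "y k = (\<Sum>j=1..k. cnj (f (e j)) *\<^sub>C e j)" for k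
  have f_P: "f (P k x) = cinner x (y k)" for k x
    by (simp add: f_def P_def proj_apply y_def blinfun.sum_right bounded_opsD[OF A]
        cinner_sum_left cinner_sum_right cinner_scaleC_left cinner_scaleC_right mult.commute)
  have cinner_y: "cinner (y k) (e j) = cnj (f (e j))" if "j \<in> {1..k}" for j k
  proof -
    have "cinner (y k) (e j) = (\<Sum>i=1..k. cnj (f (e i)) * (if i = j then 1 else 0))"
      unfolding y_def cinner_sum_left cinner_scaleC_left using that
      by (intro sum.cong refl) (simp add: cinner_basis)
    then show ?thesis using that by (simp add: if_distrib cong: if_cong)
  qed
  have P_y: "P m (y k) = y m" if "m \<le> k" for m k
    unfolding P_def proj_apply y_def[of m] using that
    by (intro sum.cong refl) (simp add: cinner_y)
  have bound: "norm (y k) \<le> norm A * norm v" for k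
  proof -
    have "(norm (y k))\<^sup>2 \<le> cmod (cinner (y k) (y k))"
      by (simp add: norm_sq_eq_cinner complex_Re_le_cmod)
    also have "\<dots> = cmod (f (y k))"
      using f_P[of k "y k"] P_y[of k k] by simp
    also have "\<dots> \<le> norm (blinfun_apply A (y k)) * norm v"
      unfolding f_def by (rule cmod_cinner_le)
    also have "\<dots> \<le> norm A * norm (y k) * norm v"
      by (intro mult_right_mono norm_blinfun) simp
    finally have "norm (y k) * norm (y k) \<le> norm A * norm v * norm (y k)"
      by (simp add: power2_eq_square mult_ac)
    then show ?thesis
      by (cases "y k = 0") auto
  qed
  have dist_y: "(dist (y k) (y m))\<^sup>2 = (norm (y k))\<^sup>2 - (norm (y m))\<^sup>2" if "m \<le> k" for m k
    using norm_diff_proj_sq[of "y k" m] P_y[OF that] by (simp add: P_def dist_norm)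
  have "convergent (\<lambda>k. (norm (y k))\<^sup>2)"
  proof (rule Bseq_monoseq_convergent)
    show "Bseq (\<lambda>k. (norm (y k))\<^sup>2)"
      by (rule BseqI'[of _ "(norm A * norm v)\<^sup>2"]) (use bound in \<open>simp add: power_mono\<close>)
    have "(norm (y m))\<^sup>2 \<le> (norm (y k))\<^sup>2" if "m \<le> k" for m k
      using dist_y[OF that] zero_le_power2[of "dist (y k) (y m)"] by linarith
    then show "monoseq (\<lambda>k. (norm (y k))\<^sup>2)" by (auto simp: monoseq_def)
  qed
  then have Cauchy_sq: "Cauchy (\<lambda>k. (norm (y k))\<^sup>2)" by (rule convergent_Cauchy)
  have "Cauchy y"
    unfolding Cauchy_altdef
  proof (intro allI impI)
    fix \<epsilon> :: real assume \<epsilon>: "\<epsilon> > 0"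
    then obtain M where M: "\<And>m n. m \<ge> M \<Longrightarrow> n > m \<Longrightarrow> dist ((norm (y m))\<^sup>2) ((norm (y n))\<^sup>2) < \<epsilon>\<^sup>2"
      using Cauchy_sq unfolding Cauchy_altdef by (meson zero_less_power)
    have "dist (y m) (y n) < \<epsilon>" if "m \<ge> M" "n > m" for m n
    proof -
      have "(dist (y m) (y n))\<^sup>2 < \<epsilon>\<^sup>2"
        using dist_y[of m n] M[OF that] that(2) by (simp add: dist_commute dist_real_def abs_if split: if_splits)
      then show ?thesis using \<epsilon> by (simp add: power_less_imp_less_base)
    qed
    then show "\<exists>M. \<forall>m\<ge>M. \<forall>n>m. dist (y m) (y n) < \<epsilon>" by blast
  qed
  then obtain u where u: "y \<longlonglongrightarrow> u" by (metis Cauchy_convergent convergent_def)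
  have "f x = cinner x u" for x
  proof (rule LIMSEQ_unique)
    show "(\<lambda>k. cinner x (y k)) \<longlonglongrightarrow> cinner x u"
      by (rule bounded_linear.tendsto[OF bounded_linear_cinner_right u])
    have "(\<lambda>k. f (P k x)) \<longlonglongrightarrow> f x"
      unfolding f_def P_def
      by (intro bounded_linear.tendsto[OF bounded_linear_cinner_left]
          bounded_linear.tendsto[OF blinfun.bounded_linear_right] proj_tendsto)
    then show "(\<lambda>k. cinner x (y k)) \<longlonglongrightarrow> f x" by (simp add: f_P)
  qed
  then show ?thesis unfolding f_def by blast
qed

end

section \<open>Separability of the space of compact operators\<close>

lemma closure_add:
  fixes S :: "'a::real_normed_vector set"
  assumes "\<And>x y. x \<in> S \<Longrightarrow> y \<in> S \<Longrightarrow> x + y \<in> S" and "x \<in> closure S" "y \<in> closure S"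
  shows "x + y \<in> closure S"
proof -
  obtain s t where "\<And>n. s n \<in> S" "s \<longlonglongrightarrow> x" "\<And>n. t n \<in> S" "t \<longlonglongrightarrow> y"
    using assms(2,3) unfolding closure_sequential by blast
  then show ?thesis
    unfolding closure_sequential using assms(1)
    by (intro exI[of _ "\<lambda>n. s n + t n"]) (auto intro: tendsto_add)
qed

lemma subspace_closure:
  fixes S :: "'a::real_normed_vector set"
  assumes "subspace S"
  shows "subspace (closure S)"
  unfolding subspace_def
proof (intro conjI ballI allI)
  show "0 \<in> closure S" using subspace_0[OF assms] closure_subset by blast
  show "x + y \<in> closure S" if "x \<in> closure S" "y \<in> closure S" for x y
    using subspace_add[OF assms] that by (rule closure_add)
  have "(*\<^sub>R) c ` closure S \<subseteq> closure S" for c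
    using subspace_scale[OF assms] closure_subset
    by (intro image_closure_subset) (auto intro!: continuous_intros)
  then show "c *\<^sub>R x \<in> closure S" if "x \<in> closure S" for c x
    using that by blast
qed

text \<open>The finite combinations with rational coefficients are dense in the real span.\<close>
lemma span_range_separable:
  fixes B :: "'i::countable \<Rightarrow> 'a::real_normed_vector"
  shows "\<exists>Q. countable Q \<and> Q \<subseteq> span (range B) \<and> span (range B) \<subseteq> closure Q"
proof -
  define comb where "comb xs = (\<Sum>(q, i)\<leftarrow>xs. of_rat q *\<^sub>R B i)" for xs :: "(rat \<times> 'i) list"
  define Q where "Q = range comb"
  have "comb xs \<in> span (range B)" for xs
  proof (induction xs)
    case (Cons p xs)
    then show ?case
      by (cases p) (simp add: comb_def span_add span_scale span_base)
  qed (simp add: comb_def span_zero)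
  moreover have "x \<in> closure Q" if "x \<in> span (range B)" for x
    using that
  proof (induction rule: span_induct_alt)
    case base
    have "0 \<in> Q" using rangeI[of comb "[]"] by (simp add: Q_def comb_def)
    then show ?case using closure_subset by blast
  next
    case (step c b y)
    then obtain i where b: "b = B i" by blast
    have "(\<lambda>a. a *\<^sub>R b) ` closure \<rat> \<subseteq> closure Q"
    proof (rule image_closure_subset)
      have "of_rat q *\<^sub>R b \<in> Q" for q
        using rangeI[of comb "[(q, i)]"] by (simp add: Q_def comb_def b)
      then show "(\<lambda>a. a *\<^sub>R b) ` \<rat> \<subseteq> closure Q"
        using closure_subset by (fastforce simp: Rats_def)
    qed (auto intro: continuous_intros)
    then have "c *\<^sub>R b \<in> closure Q" by (auto simp: Rats_closure_real)
    moreover have "u + v \<in> Q" if uv: "u \<in> Q" "v \<in> Q" for u v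
    proof -
      obtain xs ys where "u = comb xs" "v = comb ys" using uv by (auto simp: Q_def)
      then have "u + v = comb (xs @ ys)" by (simp add: comb_def)
      then show ?thesis by (simp add: Q_def)
    qed
    ultimately show ?case
      using step.IH by (intro closure_add)
  qed
  ultimately show ?thesis
    by (intro exI[of _ Q]) (auto simp: Q_def)
qed

text \<open>
  The rank-one operators built from the basis vectors span a dense subspace: rank-one operators
  depend continuously on their two vectors, and a compact operator \<open>A\<close> is the limit of \<open>P\<^sub>m A\<close>,
  where each \<open>P\<^sub>m A\<close> is a finite sum of rank-one operators.
\<close>
lemma compact_ops_separable:
  fixes e :: "nat \<Rightarrow> 'h::complex_hilbert"
  assumes e: "orthonormal_basis e"
  shows "\<exists>Q :: ('h \<Rightarrow>\<^sub>L 'h) set. countable Q \<and> Q \<subseteq> compact_ops \<and> compact_ops \<subseteq> closure Q"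
proof -
  \<comment> \<open>The factor \<open>\<i>\<close> is needed because the span is a real one. The vector \<open>e 0\<close>, which is not part
    of the basis, does no harm: all rank-one operators are compact.\<close>
  define B where "B = (\<lambda>(i, j, b). rank_one (e i) ((if b then 1 else \<i>) *\<^sub>C e j))"
  define C where "C = closure (span (range B))"
  have sub: "subspace C" unfolding C_def by (intro subspace_closure subspace_span)
  have lim: "A \<in> C" if "\<And>n. s n \<in> C" "s \<longlonglongrightarrow> A" for s :: "nat \<Rightarrow> _" and A
    using closed_sequentially[of C s A] that by (simp add: C_def)
  have basis: "rank_one (e i) (c *\<^sub>C e j) \<in> C" for i j c
  proof -
    have "B (i, j, b) \<in> C" for b
      unfolding C_def using closure_subset span_base[of "B (i, j, b)" "range B"] by blast
    from this[of True] this[of False]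
    have "rank_one (e i) (e j) \<in> C" "rank_one (e i) (\<i> *\<^sub>C e j) \<in> C" by (simp_all add: B_def)
    then have "Re c *\<^sub>R rank_one (e i) (e j) + Im c *\<^sub>R rank_one (e i) (\<i> *\<^sub>C e j) \<in> C"
      by (intro subspace_add[OF sub] subspace_scale[OF sub])
    then show ?thesis
      unfolding scaleC_real_combination[of c]
      by (simp add: bounded_bilinear.scaleR_right[OF bounded_bilinear_rank_one] rank_one_linear)
  qed
  have right: "rank_one (e i) v \<in> C" for i v
  proof (rule lim)
    show "(\<lambda>m. rank_one (e i) (blinfun_apply (orth_proj (basis_span e m)) v)) \<longlonglongrightarrow> rank_one (e i) v"
      by (intro bounded_bilinear.tendsto[OF bounded_bilinear_rank_one] tendsto_const proj_tendsto[OF e])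
    show "rank_one (e i) (blinfun_apply (orth_proj (basis_span e m)) v) \<in> C" for m
      unfolding proj_apply[OF e] bounded_bilinear.sum_right[OF bounded_bilinear_rank_one]
      by (intro subspace_sum[OF sub] basis)
  qed
  have rank_one: "rank_one u v \<in> C" for u v
  proof (rule lim)
    show "(\<lambda>m. rank_one (blinfun_apply (orth_proj (basis_span e m)) u) v) \<longlonglongrightarrow> rank_one u v"
      by (intro bounded_bilinear.tendsto[OF bounded_bilinear_rank_one] tendsto_const proj_tendsto[OF e])
    show "rank_one (blinfun_apply (orth_proj (basis_span e m)) u) v \<in> C" for m
      unfolding proj_apply[OF e] bounded_bilinear.sum_left[OF bounded_bilinear_rank_one] rank_one_linear(3)
      by (intro subspace_sum[OF sub] right)
  qed
  have "compact_ops \<subseteq> C"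
  proof
    fix A :: "'h \<Rightarrow>\<^sub>L 'h" assume A: "A \<in> compact_ops"
    have "\<exists>u. \<forall>x. cinner (blinfun_apply A x) v = cinner x u" for v
      using A compact_ops_subset by (intro adjoint_vector_exists[OF e]) blast
    then obtain u where u: "\<And>v x. cinner (blinfun_apply A x) v = cinner x (u v)" by metis
    show "A \<in> C"
    proof (rule lim[OF _ proj_compose_tendsto[OF e A]])
      fix m
      have "orth_proj (basis_span e m) o\<^sub>L A = (\<Sum>j=1..m. rank_one (u (e j)) (e j))"
        by (rule blinfun_eqI) (simp add: proj_apply[OF e] blinfun.sum_left u)
      then show "orth_proj (basis_span e m) o\<^sub>L A \<in> C"
        by (simp add: subspace_sum[OF sub] rank_one)
    qed
  qed
  moreover obtain Q where Q: "countable Q" "Q \<subseteq> span (range B)" "span (range B) \<subseteq> closure Q"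
    using span_range_separable by blast
  moreover have "span (range B) \<subseteq> compact_ops"
    by (rule span_minimal[OF _ subspace_compact_ops]) (auto simp: B_def rank_one_in_compact_ops)
  moreover have "C \<subseteq> closure Q"
    unfolding C_def using Q(3) by (intro closure_minimal) auto
  ultimately show ?thesis by (intro exI[of _ Q]) auto
qed

section \<open>Unitary operators and the shift condition\<close>

lemma unitary_op_imp_invertible:
  assumes "unitary_op U"
  shows "invertible_op U"
proof -
  have U: "U \<in> bounded_ops" "surj (blinfun_apply U)"
      and iso: "\<And>x y. cinner (blinfun_apply U x) (blinfun_apply U y) = cinner x y"
    using assms by (auto simp: unitary_op_def)
  have norm_U: "norm (blinfun_apply U x) = norm x" for x
    by (rule power2_eq_imp_eq) (simp_all add: norm_sq_eq_cinner iso)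
  have inj: "inj (blinfun_apply U)"
  proof (rule injI)
    fix x y assume "blinfun_apply U x = blinfun_apply U y"
    then show "x = y" using norm_U[of "x - y"] by (simp add: blinfun.diff_right)
  qed
  define g where "g = inv (blinfun_apply U)"
  have Ug: "blinfun_apply U (g x) = x" for x
    unfolding g_def using U(2) by (rule surj_f_inv_f)
  have gU: "g (blinfun_apply U x) = x" for x
    unfolding g_def using inj by (rule inv_f_f)
  have "bounded_linear g"
  proof (rule bounded_linear_intro[of _ 1])
    show "g (x + y) = g x + g y" for x y
      by (metis Ug gU blinfun.add_right)
    show "g (a *\<^sub>R x) = a *\<^sub>R g x" for a x
      by (metis Ug gU blinfun.scaleR_right)
    show "norm (g x) \<le> norm x * 1" for x
      using norm_U[of "g x"] by (simp add: Ug)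
  qed
  then have g: "blinfun_apply (Blinfun g) = g" by (rule bounded_linear_Blinfun_apply)
  have "g (c *\<^sub>C x) = c *\<^sub>C g x" for c x
    by (metis Ug gU bounded_opsD[OF U(1)])
  then have "Blinfun g \<in> bounded_ops" by (simp add: bounded_ops_def g)
  moreover have "U o\<^sub>L Blinfun g = id_blinfun" "Blinfun g o\<^sub>L U = id_blinfun"
    by (rule blinfun_eqI, simp add: g Ug gU)+
  ultimately show ?thesis using U(1) unfolding invertible_op_def by blast
qed

context
  fixes U :: "'h::complex_hilbert \<Rightarrow>\<^sub>L 'h"
  assumes U: "unitary_op U"
begin

lemma cinner_unitary_power:
  "cinner (blinfun_apply (op_power U n) x) (blinfun_apply (op_power U n) y) = cinner x y"
proof (induction n)
  case (Suc n)
  then show ?case using U by (simp add: op_power_Suc unitary_op_def)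
qed simp

lemma unitary_power_inverse:
  "op_power U n o\<^sub>L op_power (op_inverse U) n = id_blinfun"
  "op_power (op_inverse U) n o\<^sub>L op_power U n = id_blinfun"
  using op_inverse[OF unitary_op_imp_invertible[OF U]] by (simp_all add: op_power_inverse)

lemma cinner_unitary_inverse_power:
  "cinner (blinfun_apply (op_power (op_inverse U) n) x) y = cinner x (blinfun_apply (op_power U n) y)"
proof -
  have "blinfun_apply (op_power U n) (blinfun_apply (op_power (op_inverse U) n) x) = x"
    using unitary_power_inverse(1)[of n] by (metis blinfun_apply_blinfun_compose blinfun_apply_id_blinfun id_apply)
  then show ?thesis
    by (metis cinner_unitary_power)
qed

lemma norm_unitary_power: "norm (blinfun_apply (op_power U n) x) = norm x"
  by (rule power2_eq_imp_eq) (simp_all add: norm_sq_eq_cinner cinner_unitary_power)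

lemma norm_unitary_power_le: "norm (op_power U n) \<le> 1"
  by (rule norm_blinfun_bound) (simp_all add: norm_unitary_power)

lemma norm_unitary_inverse_power_le: "norm (op_power (op_inverse U) n) \<le> 1"
proof (rule norm_blinfun_bound)
  fix x
  have "blinfun_apply (op_power U n) (blinfun_apply (op_power (op_inverse U) n) x) = x"
    using unitary_power_inverse(1)[of n] by (metis blinfun_apply_blinfun_compose blinfun_apply_id_blinfun id_apply)
  then show "norm (blinfun_apply (op_power (op_inverse U) n) x) \<le> 1 * norm x"
    using norm_unitary_power[of n "blinfun_apply (op_power (op_inverse U) n) x"] by simp
qed simp

text \<open>
  If \<open>U\<^sup>n L \<bottom> L\<close> for all \<open>n \<ge> M\<close>, then the compression of \<open>U\<^sup>d\<close> to \<open>L\<close> vanishes for every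
  integer \<open>d\<close> with \<open>\<bar>d\<bar> \<ge> M\<close>; here \<open>d = a - b\<close>.
\<close>
lemma compression_unitary_power_eq_0:
  assumes e: "orthonormal_basis e"
    and orth: "\<And>n. n \<ge> M \<Longrightarrow> orthogonal_sets (blinfun_apply (op_power U n) ` basis_span e m) (basis_span e m)"
    and ab: "b + M \<le> a \<or> a + M \<le> b"
  shows "orth_proj (basis_span e m) o\<^sub>L (op_power (op_inverse U) b o\<^sub>L op_power U a) o\<^sub>L orth_proj (basis_span e m) = 0"
proof (rule blinfun_eqI)
  fix x
  let ?P = "blinfun_apply (orth_proj (basis_span e m))"
  have Px: "?P x \<in> basis_span e m" by (rule proj_in_span[OF e])
  have "?P (blinfun_apply (op_power (op_inverse U) b) (blinfun_apply (op_power U a) (?P x))) = 0"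
  proof (rule proj_eq_0[OF e])
    fix y assume y: "y \<in> basis_span e m"
    have "cinner (blinfun_apply (op_power U a) (?P x)) (blinfun_apply (op_power U b) y) = 0"
    proof (cases "b + M \<le> a")
      case True
      then have "op_power U a = op_power U b o\<^sub>L op_power U (a - b)"
        using op_power_add[of U b "a - b"] by simp
      then have "cinner (blinfun_apply (op_power U a) (?P x)) (blinfun_apply (op_power U b) y)
          = cinner (blinfun_apply (op_power U (a - b)) (?P x)) y"
        by (simp add: cinner_unitary_power)
      also have "\<dots> = 0"
        using orth[of "a - b"] True Px y by (auto simp: orthogonal_sets_def)
      finally show ?thesis .
    next
      case False
      then have "a + M \<le> b" using ab by blast
      then have "op_power U b = op_power U a o\<^sub>L op_power U (b - a)"
        using op_power_add[of U a "b - a"] by simp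
      then have "cinner (blinfun_apply (op_power U a) (?P x)) (blinfun_apply (op_power U b) y)
          = cnj (cinner (blinfun_apply (op_power U (b - a)) y) (?P x))"
        by (simp add: cinner_unitary_power flip: cinner_commute)
      also have "\<dots> = 0"
        using orth[of "b - a"] \<open>a + M \<le> b\<close> Px y by (auto simp: orthogonal_sets_def)
      finally show ?thesis .
    qed
    then show "cinner (blinfun_apply (op_power (op_inverse U) b) (blinfun_apply (op_power U a) (?P x))) y = 0"
      by (simp add: cinner_unitary_inverse_power)
  qed
  then show "blinfun_apply (orth_proj (basis_span e m) o\<^sub>L (op_power (op_inverse U) b o\<^sub>L op_power U a)
      o\<^sub>L orth_proj (basis_span e m)) x = blinfun_apply 0 x"
    by simp
qed

end

section \<open>The approximation condition\<close>

text \<open>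
  The norm estimates of the sequential condition at a single time \<open>n\<close>, with error bound \<open>\<delta>\<close>;
  \<open>P\<close> is the projection to be approximated.
\<close>
definition approx_system :: "nat \<Rightarrow> (nat \<Rightarrow> 'h::complex_hilbert \<Rightarrow>\<^sub>L 'h) \<Rightarrow> (nat \<Rightarrow> nat) \<Rightarrow> ('h \<Rightarrow>\<^sub>L 'h)
    \<Rightarrow> nat \<Rightarrow> ('h \<Rightarrow>\<^sub>L 'h) \<Rightarrow> (nat \<Rightarrow> 'h \<Rightarrow>\<^sub>L 'h) \<Rightarrow> real \<Rightarrow> bool" where
  "approx_system N W r P n D G \<delta> \<longleftrightarrow>
     (\<forall>l\<in>{1..N}. norm (D - P) < \<delta> \<and> norm (G l - P) < \<delta> \<and>
        norm (op_power (W l) (r l * n) o\<^sub>L D) < \<delta> \<and>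
        norm (op_power (op_inverse (W l)) (r l * n) o\<^sub>L G l) < \<delta>) \<and>
     (\<forall>s\<in>{1..N}. \<forall>l\<in>{1..N}. s \<noteq> l \<longrightarrow>
        norm (op_power (W l) (r l * n) o\<^sub>L op_power (op_inverse (W s)) (r s * n) o\<^sub>L G s) < \<delta>)"

lemma approx_systems_imp_sequences:
  assumes "\<And>\<delta> M. \<delta> > 0 \<Longrightarrow> \<exists>n>M. \<exists>D\<in>compact_ops. \<exists>G. (\<forall>l\<in>{1..N}. G l \<in> compact_ops) \<and>
    approx_system N W r P n D G \<delta>"
  shows "\<exists>(D :: nat \<Rightarrow> 'h::complex_hilbert \<Rightarrow>\<^sub>L 'h) (G :: nat \<Rightarrow> nat \<Rightarrow> 'h \<Rightarrow>\<^sub>L 'h) (n :: nat \<Rightarrow> nat).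
        (\<forall>k. D k \<in> compact_ops) \<and>
        (\<forall>l\<in>{1..N}. \<forall>k. G l k \<in> compact_ops) \<and>
        strict_mono n \<and> (\<forall>k. n k \<ge> 1) \<and>
        (\<forall>l\<in>{1..N}.
           (\<lambda>k. norm (D k - P)) \<longlonglongrightarrow> 0 \<and>
           (\<lambda>k. norm (G l k - P)) \<longlonglongrightarrow> 0 \<and>
           (\<lambda>k. norm (op_power (W l) (r l * n k) o\<^sub>L D k)) \<longlonglongrightarrow> 0 \<and>
           (\<lambda>k. norm (op_power (op_inverse (W l)) (r l * n k) o\<^sub>L G l k)) \<longlonglongrightarrow> 0) \<and>
        (\<forall>s\<in>{1..N}. \<forall>l\<in>{1..N}. s \<noteq> l \<longrightarrow>
           (\<lambda>k. norm (op_power (W l) (r l * n k) o\<^sub>L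
                      op_power (op_inverse (W s)) (r s * n k) o\<^sub>L G s k)) \<longlonglongrightarrow> 0)"
proof -
  define R where "R k n \<longleftrightarrow> n \<ge> 1 \<and> (\<exists>D\<in>compact_ops. \<exists>G. (\<forall>l\<in>{1..N}. G l \<in> compact_ops) \<and>
    approx_system N W r P n D G (1 / real (Suc k)))" for k n
  have ex: "\<exists>n>M. R k n" for k M
  proof -
    obtain n where "n > M" "\<exists>D\<in>compact_ops. \<exists>G. (\<forall>l\<in>{1..N}. G l \<in> compact_ops) \<and>
        approx_system N W r P n D G (1 / real (Suc k))"
      using assms[of "1 / real (Suc k)" M] by auto
    then show ?thesis unfolding R_def by (intro exI[of _ n]) simp
  qed
  have "\<exists>n. \<forall>k. R k (n k) \<and> n k < n (Suc k)"
    by (rule dependent_nat_choice) (use ex in blast)+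
  then obtain n where n: "\<And>k. R k (n k)" "strict_mono n"
    by (auto simp: strict_mono_Suc_iff)
  then have "\<forall>k. \<exists>D G. D \<in> compact_ops \<and> (\<forall>l\<in>{1..N}. G l \<in> compact_ops) \<and>
      approx_system N W r P (n k) D G (1 / real (Suc k))"
    unfolding R_def by blast
  then obtain D G where DG: "\<And>k. D k \<in> compact_ops" "\<And>k l. l \<in> {1..N} \<Longrightarrow> G k l \<in> compact_ops"
      "\<And>k. approx_system N W r P (n k) (D k) (G k) (1 / real (Suc k))"
    by metis
  note * = DG(3)[unfolded approx_system_def]
  have lim: "(\<lambda>k. norm (Z k)) \<longlonglongrightarrow> 0" if "\<And>k. norm (Z k) < 1 / real (Suc k)" for Z :: "nat \<Rightarrow> 'h \<Rightarrow>\<^sub>L 'h"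
    using tendsto_norm_zero[OF LIMSEQ_norm_0[OF that]] .
  show ?thesis
  proof (intro exI[of _ D] exI[of _ "\<lambda>l k. G k l"] exI[of _ n] conjI ballI allI impI lim)
    show "1 \<le> n k" for k using n(1) by (simp add: R_def)
  qed (use DG(1,2) n(2) * in blast)+
qed

lemma sequences_imp_approx_system:
  fixes D :: "nat \<Rightarrow> 'h::complex_hilbert \<Rightarrow>\<^sub>L 'h" and G :: "nat \<Rightarrow> nat \<Rightarrow> 'h \<Rightarrow>\<^sub>L 'h"
  assumes lim: "\<And>l. l \<in> {1..N} \<Longrightarrow>
           (\<lambda>k. norm (D k - P)) \<longlonglongrightarrow> 0 \<and>
           (\<lambda>k. norm (G l k - P)) \<longlonglongrightarrow> 0 \<and>
           (\<lambda>k. norm (op_power (W l) (r l * n k) o\<^sub>L D k)) \<longlonglongrightarrow> 0 \<and>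
           (\<lambda>k. norm (op_power (op_inverse (W l)) (r l * n k) o\<^sub>L G l k)) \<longlonglongrightarrow> 0"
    and cross: "\<And>s l. s \<in> {1..N} \<Longrightarrow> l \<in> {1..N} \<Longrightarrow> s \<noteq> l \<Longrightarrow>
           (\<lambda>k. norm (op_power (W l) (r l * n k) o\<^sub>L
                      op_power (op_inverse (W s)) (r s * n k) o\<^sub>L G s k)) \<longlonglongrightarrow> 0"
    and \<delta>: "\<delta> > 0"
  shows "\<exists>k. approx_system N W r P (n k) (D k) (\<lambda>l. G l k) \<delta>"
proof -
  have "\<forall>\<^sub>F k in sequentially. approx_system N W r P (n k) (D k) (\<lambda>l. G l k) \<delta>"
    unfolding approx_system_def
  proof (intro eventually_conj eventually_ball_finite ballI finite_atLeastAtMost)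
    fix l assume l: "l \<in> {1..N}"
    note * = lim[OF l]
    show "\<forall>\<^sub>F k in sequentially. norm (D k - P) < \<delta>"
      "\<forall>\<^sub>F k in sequentially. norm (G l k - P) < \<delta>"
      "\<forall>\<^sub>F k in sequentially. norm (op_power (W l) (r l * n k) o\<^sub>L D k) < \<delta>"
      "\<forall>\<^sub>F k in sequentially. norm (op_power (op_inverse (W l)) (r l * n k) o\<^sub>L G l k) < \<delta>"
      using * \<delta> by (auto intro: order_tendstoD(2))
  next
    fix s l assume "s \<in> {1..N}" "l \<in> {1..N}"
    then show "\<forall>\<^sub>F k in sequentially. s \<noteq> l \<longrightarrow>
        norm (op_power (W l) (r l * n k) o\<^sub>L op_power (op_inverse (W s)) (r s * n k) o\<^sub>L G s k) < \<delta>"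
      using order_tendstoD(2)[OF cross \<delta>] by (cases "s = l") auto
  qed
  then show ?thesis by (rule eventually_happens'[OF sequentially_bot])
qed

section \<open>From d-hypercyclic vectors to approximating operators\<close>

text \<open>
  Let \<open>F\<close> be close to \<open>P\<close> and \<open>W\<^sub>l\<^sup>a F U\<^sup>a\<close> close to \<open>P\<close>, for \<open>a = r\<^sub>l n\<close>. Put \<open>D = F P\<close> and
  \<open>G\<^sub>l = W\<^sub>l\<^sup>a F U\<^sup>a P\<close>. Each of the remaining products has the form \<open>K Z P\<close> with \<open>K\<close> close to \<open>P\<close>
  and \<open>Z\<close> a power of \<open>U\<close> of large exponent in absolute value, so that \<open>P Z P = 0\<close>.
\<close>
lemma approx_system_if_orbit_near:
  fixes e :: "nat \<Rightarrow> 'h::complex_hilbert" and W :: "nat \<Rightarrow> 'h \<Rightarrow>\<^sub>L 'h"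
  assumes e: "orthonormal_basis e" and U: "unitary_op U"
    and W: "\<And>l. l \<in> {1..N} \<Longrightarrow> invertible_op (W l)"
    and orth: "\<And>k. k \<ge> M \<Longrightarrow> orthogonal_sets (blinfun_apply (op_power U k) ` basis_span e m) (basis_span e m)"
    and r_pos: "\<And>l. l \<in> {1..N} \<Longrightarrow> 0 < r l" and r_mono: "strict_mono_on {1..N} r"
    and n: "n \<ge> M"
    and F: "F \<in> compact_ops" "norm (F - orth_proj (basis_span e m)) < \<delta>"
    and near: "\<And>l. l \<in> {1..N} \<Longrightarrow>
      norm ((op_power (W l) (r l * n) o\<^sub>L F o\<^sub>L op_power U (r l * n)) - orth_proj (basis_span e m)) < \<delta>"
  shows "\<exists>D\<in>compact_ops. \<exists>G. (\<forall>l\<in>{1..N}. G l \<in> compact_ops) \<and>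
    approx_system N W r (orth_proj (basis_span e m)) n D G \<delta>"
proof -
  define P where "P = orth_proj (basis_span e m)"
  define u where "u = op_power U"
  define v where "v = op_power (op_inverse U)"
  define A where "A l = op_power (W l) (r l * n)" for l
  define B where "B l = op_power (op_inverse (W l)) (r l * n)" for l
  define K where "K l = A l o\<^sub>L F o\<^sub>L u (r l * n)" for l
  define G where "G l = K l o\<^sub>L P" for l
  have BA: "B l o\<^sub>L A l = id_blinfun" if "l \<in> {1..N}" for l
    unfolding A_def B_def using op_inverse(3)[OF W[OF that]] by (rule op_power_inverse)
  have uv: "u k o\<^sub>L v k = id_blinfun" for k
    unfolding u_def v_def by (rule unitary_power_inverse(1)[OF U])
  have P: "norm P \<le> 1" "P o\<^sub>L P = P" "P \<in> bounded_ops"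
    unfolding P_def by (rule norm_proj_le[OF e] proj_idem[OF e] proj_in_bounded_ops[OF e])+
  have K: "norm (K l - P) < \<delta>" if "l \<in> {1..N}" for l
    using near[OF that] by (simp add: K_def A_def u_def P_def)
  have compress: "norm (L o\<^sub>L (v b o\<^sub>L u a) o\<^sub>L P) < \<delta>"
    if L: "norm (L - P) < \<delta>" and ab: "b + M \<le> a \<or> a + M \<le> b" for L a b
  proof -
    have "P o\<^sub>L (v b o\<^sub>L u a) o\<^sub>L P = 0"
      unfolding P_def u_def v_def using compression_unitary_power_eq_0[OF U e orth ab] .
    then have "L o\<^sub>L (v b o\<^sub>L u a) o\<^sub>L P = (L - P) o\<^sub>L (v b o\<^sub>L u a) o\<^sub>L P"
      by (simp add: blinfun_compose_distribs)
    also have "norm \<dots> \<le> norm (L - P) * (1 * 1) * 1"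
      unfolding u_def v_def
      by (intro norm_blinfun_compose_le norm_unitary_power_le[OF U] norm_unitary_inverse_power_le[OF U] P order_refl)
    finally show ?thesis using L by simp
  qed
  \<comment> \<open>The exponents \<open>r l * n\<close> are at least \<open>M\<close> apart from \<open>0\<close> and from each other.\<close>
  have r_n: "M \<le> r l * n" if "l \<in> {1..N}" for l
    using order_trans[OF n, of "r l * n"] r_pos[OF that] by simp
  have gap: "r s * n + M \<le> r l * n" if "s \<in> {1..N}" "l \<in> {1..N}" "s < l" for s l
  proof -
    have "r s + 1 \<le> r l" using strict_mono_onD[OF r_mono that] by simp
    then have "(r s + 1) * n \<le> r l * n" by (rule mult_le_mono1)
    then show ?thesis using n by simp
  qed
  have "F o\<^sub>L P \<in> compact_ops"
    using F(1) P(3) by (rule compose_right_in_compact_ops)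
  moreover have "G l \<in> compact_ops" if "l \<in> {1..N}" for l
    unfolding G_def K_def A_def u_def
    using W[OF that] U F(1) P(3)
    by (intro compose_right_in_compact_ops compose_left_in_compact_ops op_power_in_bounded_ops)
       (auto simp: invertible_op_def unitary_op_def)
  moreover have "approx_system N W r P n (F o\<^sub>L P) G \<delta>"
    unfolding approx_system_def A_def[symmetric] B_def[symmetric]
  proof (intro conjI ballI impI)
    fix l assume l: "l \<in> {1..N}"
    have right: "norm ((L o\<^sub>L P) - P) < \<delta>" if "norm (L - P) < \<delta>" for L
    proof -
      have "(L o\<^sub>L P) - P = (L - P) o\<^sub>L P" by (simp add: blinfun_compose_distribs P)
      also have "norm \<dots> \<le> norm (L - P) * 1" by (intro norm_blinfun_compose_le order_refl P)
      finally show ?thesis using that by simp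
    qed
    show "norm ((F o\<^sub>L P) - P) < \<delta>" using F(2) by (intro right) (simp add: P_def)
    show "norm (G l - P) < \<delta>" unfolding G_def using K[OF l] by (rule right)
    have "A l o\<^sub>L (F o\<^sub>L P) = K l o\<^sub>L (v (r l * n) o\<^sub>L u 0) o\<^sub>L P"
      using uv[of "r l * n"] unfolding K_def u_def op_power_0
      by (metis blinfun_compose_assoc blinfun_compose_id(2))
    then show "norm (A l o\<^sub>L (F o\<^sub>L P)) < \<delta>"
      using compress[OF K[OF l], of "r l * n" 0] r_n[OF l] by simp
    have "B l o\<^sub>L G l = (B l o\<^sub>L A l) o\<^sub>L F o\<^sub>L u (r l * n) o\<^sub>L P"
      by (simp only: G_def K_def blinfun_compose_assoc)
    also have "\<dots> = F o\<^sub>L (v 0 o\<^sub>L u (r l * n)) o\<^sub>L P"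
      by (simp add: BA[OF l] v_def)
    finally show "norm (B l o\<^sub>L G l) < \<delta>"
      using compress[of F 0 "r l * n"] r_n[OF l] F(2) by (simp add: P_def)
  next
    fix s l assume s: "s \<in> {1..N}" and l: "l \<in> {1..N}" and "s \<noteq> l"
    have "A l o\<^sub>L B s o\<^sub>L G s = A l o\<^sub>L (B s o\<^sub>L A s) o\<^sub>L F o\<^sub>L u (r s * n) o\<^sub>L P"
      by (simp only: G_def K_def blinfun_compose_assoc)
    also have "\<dots> = A l o\<^sub>L F o\<^sub>L (u (r l * n) o\<^sub>L v (r l * n)) o\<^sub>L u (r s * n) o\<^sub>L P"
      by (simp add: BA[OF s] uv)
    also have "\<dots> = K l o\<^sub>L (v (r l * n) o\<^sub>L u (r s * n)) o\<^sub>L P"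
      by (simp only: K_def blinfun_compose_assoc)
    finally show "norm (A l o\<^sub>L B s o\<^sub>L G s) < \<delta>"
      using compress[OF K[OF l], of "r l * n" "r s * n"] gap[OF s l] gap[OF l s] \<open>s \<noteq> l\<close>
      by (metis linorder_neqE_nat)
  qed
  ultimately show ?thesis unfolding P_def by blast
qed

section \<open>From approximating operators to d-hypercyclic vectors\<close>

text \<open>
  Here \<open>A\<^sub>l, B\<^sub>l\<close> stand for \<open>W\<^sub>l\<^sup>a, W\<^sub>l\<^sup>-\<^sup>a\<close> and \<open>X\<^sub>l, Y\<^sub>l\<close> for \<open>U\<^sup>a, U\<^sup>-\<^sup>a\<close>, where \<open>a = r\<^sub>l n\<close>. The operator
  \<open>H\<close> is close to the source \<open>F\<close>, since \<open>D F\<close> is and the other summands are small; its image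
  \<open>A\<^sub>l H X\<^sub>l\<close> is close to the target \<open>R\<^sub>l\<close>, since the summand \<open>s = l\<close> becomes \<open>G\<^sub>l R\<^sub>l\<close> and the
  other ones become small.
\<close>
lemma transfer_estimate:
  fixes P D F :: "'h::real_normed_vector \<Rightarrow>\<^sub>L 'h" and A B X Y G R :: "nat \<Rightarrow> 'h \<Rightarrow>\<^sub>L 'h" and N :: nat
  defines "H \<equiv> (D o\<^sub>L F) + (\<Sum>s=1..N. B s o\<^sub>L G s o\<^sub>L R s o\<^sub>L Y s)"
  assumes AB: "\<And>l. l \<in> {1..N} \<Longrightarrow> A l o\<^sub>L B l = id_blinfun"
    and YX: "\<And>l. l \<in> {1..N} \<Longrightarrow> Y l o\<^sub>L X l = id_blinfun"
    and XY: "\<And>l. l \<in> {1..N} \<Longrightarrow> norm (X l) \<le> 1" "\<And>l. l \<in> {1..N} \<Longrightarrow> norm (Y l) \<le> 1"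
    and F: "P o\<^sub>L F = F" "norm F \<le> C"
    and R: "\<And>l. l \<in> {1..N} \<Longrightarrow> P o\<^sub>L R l = R l" "\<And>l. l \<in> {1..N} \<Longrightarrow> norm (R l) \<le> C"
    and D: "norm (D - P) \<le> \<delta>" "\<And>l. l \<in> {1..N} \<Longrightarrow> norm (A l o\<^sub>L D) \<le> \<delta>"
    and G: "\<And>l. l \<in> {1..N} \<Longrightarrow> norm (G l - P) \<le> \<delta>" "\<And>l. l \<in> {1..N} \<Longrightarrow> norm (B l o\<^sub>L G l) \<le> \<delta>"
      "\<And>s l. s \<in> {1..N} \<Longrightarrow> l \<in> {1..N} \<Longrightarrow> s \<noteq> l \<Longrightarrow> norm (A l o\<^sub>L B s o\<^sub>L G s) \<le> \<delta>"
  shows "norm (H - F) \<le> real (N + 1) * (\<delta> * C)"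
    and "l \<in> {1..N} \<Longrightarrow> norm ((A l o\<^sub>L H o\<^sub>L X l) - R l) \<le> real (N + 1) * (\<delta> * C)"
proof -
  define S where "S s = B s o\<^sub>L G s o\<^sub>L R s o\<^sub>L Y s" for s
  have sum_le: "norm (Z + (\<Sum>s=1..N. Z' s)) \<le> real (N + 1) * c"
    if "norm Z \<le> c" "\<And>s. s \<in> {1..N} \<Longrightarrow> norm (Z' s) \<le> c" for Z :: "'h \<Rightarrow>\<^sub>L 'h" and Z' c
  proof -
    have "norm (\<Sum>s=1..N. Z' s) \<le> real N * c"
      using sum_norm_bound[of "{1..N}" Z' c] that(2) by simp
    then show ?thesis
      using norm_triangle_ineq[of Z "\<Sum>s=1..N. Z' s"] that(1) by (simp add: algebra_simps)
  qed
  have "H - F = ((D - P) o\<^sub>L F) + (\<Sum>s=1..N. S s)"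
    by (simp add: H_def S_def blinfun_compose_distribs F)
  also have "norm \<dots> \<le> real (N + 1) * (\<delta> * C)"
  proof (rule sum_le)
    show "norm ((D - P) o\<^sub>L F) \<le> \<delta> * C" by (intro norm_blinfun_compose_le D F)
    fix s assume s: "s \<in> {1..N}"
    have "norm (S s) \<le> \<delta> * C * 1"
      unfolding S_def by (intro norm_blinfun_compose_le G(2) R(2) XY s)
    then show "norm (S s) \<le> \<delta> * C" by simp
  qed
  finally show "norm (H - F) \<le> real (N + 1) * (\<delta> * C)" .
  assume l: "l \<in> {1..N}"
  have "(A l o\<^sub>L H o\<^sub>L X l) - R l
      = (A l o\<^sub>L (D o\<^sub>L F) o\<^sub>L X l) + (\<Sum>s=1..N. (A l o\<^sub>L S s o\<^sub>L X l) - (if s = l then R l else 0))"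
    using l by (simp add: H_def S_def blinfun_compose_distribs sum_subtractf)
  also have "norm \<dots> \<le> real (N + 1) * (\<delta> * C)"
  proof (rule sum_le)
    have "norm ((A l o\<^sub>L D) o\<^sub>L F o\<^sub>L X l) \<le> \<delta> * C * 1" by (intro norm_blinfun_compose_le D F XY l)
    then show "norm (A l o\<^sub>L (D o\<^sub>L F) o\<^sub>L X l) \<le> \<delta> * C" by (simp add: blinfun_compose_assoc)
    fix s assume s: "s \<in> {1..N}"
    have S: "A l o\<^sub>L S s o\<^sub>L X l = (A l o\<^sub>L B s) o\<^sub>L G s o\<^sub>L R s o\<^sub>L (Y s o\<^sub>L X l)"
      by (simp only: S_def blinfun_compose_assoc)
    show "norm ((A l o\<^sub>L S s o\<^sub>L X l) - (if s = l then R l else 0)) \<le> \<delta> * C"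
    proof (cases "s = l")
      case True
      have "A l o\<^sub>L S s o\<^sub>L X l = G l o\<^sub>L R l"
        unfolding S using True l by (simp add: AB YX)
      then have "(A l o\<^sub>L S s o\<^sub>L X l) - (if s = l then R l else 0) = (G l - P) o\<^sub>L R l"
        using True l by (simp add: R blinfun_compose_distribs)
      also have "norm \<dots> \<le> \<delta> * C" by (intro norm_blinfun_compose_le G R l)
      finally show ?thesis .
    next
      case False
      have "norm ((A l o\<^sub>L B s) o\<^sub>L G s o\<^sub>L R s o\<^sub>L (Y s o\<^sub>L X l)) \<le> \<delta> * C * (1 * 1)"
        using False by (intro norm_blinfun_compose_le G R XY s l)
      then show ?thesis using False by (simp add: S)
    qed
  qed
  finally show "norm ((A l o\<^sub>L H o\<^sub>L X l) - R l) \<le> real (N + 1) * (\<delta> * C)" .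
qed

lemma transitive_if_approx_systems:
  fixes e :: "nat \<Rightarrow> 'h::complex_hilbert" and W :: "nat \<Rightarrow> 'h \<Rightarrow>\<^sub>L 'h"
  assumes e: "orthonormal_basis e" and U: "unitary_op U"
    and W: "\<And>l. l \<in> {1..N} \<Longrightarrow> invertible_op (W l)"
    and approx: "\<And>m \<delta>. m \<ge> 1 \<Longrightarrow> \<delta> > 0 \<Longrightarrow> \<exists>n. \<exists>D\<in>compact_ops. \<exists>G. (\<forall>l\<in>{1..N}. G l \<in> compact_ops) \<and>
      approx_system N W r (orth_proj (basis_span e m)) n D G \<delta>"
    and N: "N \<ge> 1"
    and x: "x \<in> compact_ops" and y: "\<And>l. l \<in> {1..N} \<Longrightarrow> y l \<in> compact_ops" and \<epsilon>: "\<epsilon> > 0"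
  shows "\<exists>h\<in>compact_ops. dist h x < \<epsilon> \<and> (\<exists>n. \<forall>l\<in>{1..N}. dist (((T_op U (W l) ^^ r l) ^^ n) h) (y l) < \<epsilon>)"
proof -
  define P where "P m = orth_proj (basis_span e m)" for m
  have ev: "\<forall>\<^sub>F m in sequentially. dist (P m o\<^sub>L Z) Z < \<epsilon> / 2" if "Z \<in> compact_ops" for Z
    unfolding P_def using \<epsilon> by (intro tendstoD[OF proj_compose_tendsto[OF e that]]) simp
  have "\<forall>\<^sub>F m in sequentially. m \<ge> 1 \<and> dist (P m o\<^sub>L x) x < \<epsilon> / 2 \<and>
      (\<forall>l\<in>{1..N}. dist (P m o\<^sub>L y l) (y l) < \<epsilon> / 2)"
    using x y by (intro eventually_conj eventually_ball_finite ballI ev eventually_ge_at_top) auto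
  then obtain m where m: "m \<ge> 1" "dist (P m o\<^sub>L x) x < \<epsilon> / 2"
      "\<And>l. l \<in> {1..N} \<Longrightarrow> dist (P m o\<^sub>L y l) (y l) < \<epsilon> / 2"
    using eventually_happens'[OF sequentially_bot] by blast
  define F where "F = P m o\<^sub>L x"
  define R where "R l = P m o\<^sub>L y l" for l
  define C where "C = 1 + norm F + (\<Sum>l=1..N. norm (R l))"
  have C: "C > 0" "norm F \<le> C"
    by (simp_all add: C_def add_pos_nonneg add_nonneg_nonneg sum_nonneg)
  have CR: "norm (R l) \<le> C" if "l \<in> {1..N}" for l
    using member_le_sum[OF that, of "\<lambda>l. norm (R l)", OF norm_ge_zero finite_atLeastAtMost] norm_ge_zero[of F] unfolding C_def by linarith
  \<comment> \<open>This choice makes the bound of \<open>transfer_estimate\<close> equal to \<open>\<epsilon> / 2\<close>.\<close>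
  define \<delta> where "\<delta> = \<epsilon> / (2 * real (N + 1) * C)"
  have \<delta>: "\<delta> > 0" "real (N + 1) * (\<delta> * C) = \<epsilon> / 2"
  proof -
    obtain q where q: "q = real (N + 1)" "q > 0" by simp
    show "\<delta> > 0" "real (N + 1) * (\<delta> * C) = \<epsilon> / 2"
      using \<epsilon> C(1) q(2) unfolding \<delta>_def q(1)[symmetric] by (simp_all add: field_simps)
  qed
  obtain n D G where D: "D \<in> compact_ops" and G: "\<And>l. l \<in> {1..N} \<Longrightarrow> G l \<in> compact_ops"
      and DG: "approx_system N W r (P m) n D G \<delta>"
    using approx[OF m(1) \<delta>(1)] unfolding P_def by blast
  define A where "A l = op_power (W l) (r l * n)" for l
  define B where "B l = op_power (op_inverse (W l)) (r l * n)" for l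
  define X where "X l = op_power U (r l * n)" for l
  define Y where "Y l = op_power (op_inverse U) (r l * n)" for l
  define H where "H = (D o\<^sub>L F) + (\<Sum>s=1..N. B s o\<^sub>L G s o\<^sub>L R s o\<^sub>L Y s)"
  have PP: "P m o\<^sub>L (P m o\<^sub>L Z) = P m o\<^sub>L Z" for Z :: "'h \<Rightarrow>\<^sub>L 'h"
    by (simp add: P_def proj_idem[OF e] flip: blinfun_compose_assoc)
  have DG_less: "norm (D - P m) < \<delta> \<and> norm (G l - P m) < \<delta> \<and> norm (A l o\<^sub>L D) < \<delta> \<and> norm (B l o\<^sub>L G l) < \<delta>"
      if "l \<in> {1..N}" for l
    using DG that unfolding approx_system_def A_def B_def by blast
  have DG_cross: "norm (A l o\<^sub>L B s o\<^sub>L G s) < \<delta>" if "s \<in> {1..N}" "l \<in> {1..N}" "s \<noteq> l" for s l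
    using DG that unfolding approx_system_def A_def B_def by blast
  have norms: "norm (D - P m) \<le> \<delta>"
    "\<And>l. l \<in> {1..N} \<Longrightarrow> norm (A l o\<^sub>L D) \<le> \<delta>"
    "\<And>l. l \<in> {1..N} \<Longrightarrow> norm (G l - P m) \<le> \<delta>"
    "\<And>l. l \<in> {1..N} \<Longrightarrow> norm (B l o\<^sub>L G l) \<le> \<delta>"
    "\<And>s l. s \<in> {1..N} \<Longrightarrow> l \<in> {1..N} \<Longrightarrow> s \<noteq> l \<Longrightarrow> norm (A l o\<^sub>L B s o\<^sub>L G s) \<le> \<delta>"
    using DG_less[of 1] N by (simp_all add: DG_less DG_cross less_imp_le)
  have AB: "A l o\<^sub>L B l = id_blinfun" if "l \<in> {1..N}" for l
    unfolding A_def B_def using op_inverse(2)[OF W[OF that]] by (rule op_power_inverse)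
  have YX: "Y l o\<^sub>L X l = id_blinfun" for l
    unfolding X_def Y_def by (rule unitary_power_inverse(2)[OF U])
  have XY: "norm (X l) \<le> 1" "norm (Y l) \<le> 1" for l
    unfolding X_def Y_def by (rule norm_unitary_power_le[OF U] norm_unitary_inverse_power_le[OF U])+
  have PF: "P m o\<^sub>L F = F" and PR: "P m o\<^sub>L R l = R l" for l
    unfolding F_def R_def by (rule PP)+
  note prems = AB YX XY PF C(2) PR CR norms
  have est_source: "norm (H - F) \<le> real (N + 1) * (\<delta> * C)"
    unfolding H_def by (rule transfer_estimate(1)[where A = A and X = X and P = "P m"]) (rule prems; assumption)+
  have est_target: "norm ((A l o\<^sub>L H o\<^sub>L X l) - R l) \<le> real (N + 1) * (\<delta> * C)" if "l \<in> {1..N}" for l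
    unfolding H_def by (rule transfer_estimate(2)[where P = "P m" and F = F, OF _ _ _ _ _ _ _ _ _ _ _ _ _ that])
      (rule prems; assumption)+
  have "H \<in> compact_ops"
  proof -
    have bdd: "P m \<in> bounded_ops" by (simp add: P_def proj_in_bounded_ops[OF e])
    have xb: "x \<in> bounded_ops" using x compact_ops_subset by blast
    have "B s o\<^sub>L G s o\<^sub>L R s o\<^sub>L Y s \<in> compact_ops" if "s \<in> {1..N}" for s
      unfolding B_def Y_def R_def
      using op_inverse(1)[OF W[OF that]] op_inverse(1)[OF unitary_op_imp_invertible[OF U]] G[OF that] y[OF that] bdd
        compact_ops_subset
      by (intro compose_right_in_compact_ops compose_left_in_compact_ops op_power_in_bounded_ops
          compose_in_bounded_ops) auto
    moreover have "D o\<^sub>L F \<in> compact_ops"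
      unfolding F_def using D bdd xb by (intro compose_right_in_compact_ops compose_in_bounded_ops)
    ultimately show ?thesis
      unfolding H_def by (intro add_in_compact_ops subspace_sum[OF subspace_compact_ops])
  qed
  moreover have "dist H x < \<epsilon>"
    using est_source \<delta>(2) m(2) dist_triangle[of H x F] by (simp add: dist_norm F_def)
  moreover have "dist (((T_op U (W l) ^^ r l) ^^ n) H) (y l) < \<epsilon>" if l: "l \<in> {1..N}" for l
  proof -
    have "((T_op U (W l) ^^ r l) ^^ n) H = A l o\<^sub>L H o\<^sub>L X l"
      by (simp add: T_op_power_power A_def X_def)
    then show ?thesis
      using est_target[OF l] \<delta>(2) m(3)[OF l] dist_triangle[of "A l o\<^sub>L H o\<^sub>L X l" "y l" "R l"]
      by (simp add: dist_norm R_def)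
  qed
  ultimately show ?thesis by blast
qed

section \<open>The equivalence\<close>

theorem theorem2p2:
  fixes e :: "nat \<Rightarrow> 'h::complex_hilbert"
    and N :: nat
    and W :: "nat \<Rightarrow> 'h \<Rightarrow>\<^sub>L 'h"
    and U :: "'h \<Rightarrow>\<^sub>L 'h"
    and r :: "nat \<Rightarrow> nat"
  assumes basis: "orthonormal_basis e"
    and N: "N \<ge> 2"
    and W: "\<And>l. l \<in> {1..N} \<Longrightarrow> invertible_op (W l)"
    and U: "unitary_op U"
    and U_orth: "\<And>k. k \<ge> 1 \<Longrightarrow> \<exists>N\<^sub>k. \<forall>n\<ge>N\<^sub>k.
           orthogonal_sets (blinfun_apply (op_power U n) ` basis_span e k) (basis_span e k)"
    and r_pos: "\<And>l. l \<in> {1..N} \<Longrightarrow> 0 < r l"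
    and r_mono: "strict_mono_on {1..N} r"
  shows
    "dense_in (top_of_set compact_ops)
       {F. d_hypercyclic_vector compact_ops N (\<lambda>l. T_op U (W l) ^^ r l) F}
     \<longleftrightarrow>
     (\<forall>m\<ge>1. \<exists>(D :: nat \<Rightarrow> 'h \<Rightarrow>\<^sub>L 'h) (G :: nat \<Rightarrow> nat \<Rightarrow> 'h \<Rightarrow>\<^sub>L 'h) (n :: nat \<Rightarrow> nat).
        (\<forall>k. D k \<in> compact_ops) \<and>
        (\<forall>l\<in>{1..N}. \<forall>k. G l k \<in> compact_ops) \<and>
        strict_mono n \<and> (\<forall>k. n k \<ge> 1) \<and>
        (\<forall>l\<in>{1..N}.
           (\<lambda>k. norm (D k - orth_proj (basis_span e m))) \<longlonglongrightarrow> 0 \<and>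
           (\<lambda>k. norm (G l k - orth_proj (basis_span e m))) \<longlonglongrightarrow> 0 \<and>
           (\<lambda>k. norm (op_power (W l) (r l * n k) o\<^sub>L D k)) \<longlonglongrightarrow> 0 \<and>
           (\<lambda>k. norm (op_power (op_inverse (W l)) (r l * n k) o\<^sub>L G l k)) \<longlonglongrightarrow> 0) \<and>
        (\<forall>s\<in>{1..N}. \<forall>l\<in>{1..N}. s \<noteq> l \<longrightarrow>
           (\<lambda>k. norm (op_power (W l) (r l * n k) o\<^sub>L
                      op_power (op_inverse (W s)) (r s * n k) o\<^sub>L G s k)) \<longlonglongrightarrow> 0))"
  (is "?dense \<longleftrightarrow> (\<forall>m\<ge>1. ?sequences m)")
proof -
  let ?T = "\<lambda>l. T_op U (W l) ^^ r l"
  have T_eq: "?T l F = op_power (W l) (r l) o\<^sub>L F o\<^sub>L op_power U (r l)" for l F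
    by (rule T_op_power)
  have Ub: "U \<in> bounded_ops" using U by (simp add: unitary_op_def)
  have T_compact: "?T l F \<in> compact_ops" if "l \<in> {1..N}" "F \<in> compact_ops" for l F
    unfolding T_eq using W[OF that(1)] that(2) Ub
    by (intro compose_right_in_compact_ops compose_left_in_compact_ops op_power_in_bounded_ops)
       (auto simp: invertible_op_def)
  have T_cont: "continuous_on UNIV (?T l)" for l
    unfolding T_eq
    by (intro bounded_bilinear.continuous_on[OF bounded_bilinear_blinfun_compose] continuous_intros)
  show ?thesis
  proof
    assume dense: ?dense
    show "\<forall>m\<ge>1. ?sequences m"
    proof (intro allI impI approx_systems_imp_sequences)
      fix m :: nat and \<delta> :: real and M' :: nat
      assume m: "m \<ge> 1" and \<delta>: "\<delta> > 0"
      define P where "P = orth_proj (basis_span e m)"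
      have P: "P \<in> compact_ops" unfolding P_def by (rule proj_in_compact_ops[OF basis])
      obtain M where M: "\<And>k. k \<ge> M \<Longrightarrow>
          orthogonal_sets (blinfun_apply (op_power U k) ` basis_span e m) (basis_span e m)"
        using U_orth[OF m] by blast
      have "P \<noteq> 0"
      proof
        assume "P = 0"
        moreover have "e 1 \<in> basis_span e m"
          unfolding basis_span_def using m by (intro cvec.span_base) auto
        ultimately have "e 1 = 0"
          using proj_fixes_span[OF basis, of "e 1" m] by (simp add: P_def)
        then show False using cinner_basis[OF basis, of 1 1] by simp
      qed
      have "P islimpt compact_ops"
      proof -
        \<comment> \<open>The multiples \<open>(1 + 1 / (k + 1)) P\<close> accumulate at \<open>P \<noteq> 0\<close>.\<close>
        have "((\<lambda>k. (1 + 1 / real (Suc k)) *\<^sub>R P) \<longlongrightarrow> (1 + 0) *\<^sub>R P) sequentially"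
          by (intro tendsto_intros LIMSEQ_Suc[OF lim_1_over_n])
        moreover have "(1 + 1 / real (Suc k)) *\<^sub>R P \<in> compact_ops - {P}" for k
        proof -
          have "(1 + 1 / real (Suc k)) *\<^sub>R P \<noteq> P"
            using \<open>P \<noteq> 0\<close> by (simp add: scaleR_left_distrib)
          then show ?thesis using scaleR_in_compact_ops[OF P] by blast
        qed
        ultimately show ?thesis
          unfolding islimpt_sequential
          by (intro exI[of _ "\<lambda>k. (1 + 1 / real (Suc k)) *\<^sub>R P"]) simp
      qed
      moreover obtain F where F: "d_hypercyclic_vector compact_ops N ?T F" "dist F P < \<delta>"
      proof -
        have "{F. d_hypercyclic_vector compact_ops N ?T F} \<subseteq> compact_ops"
          by (auto simp: d_hypercyclic_vector_def)
        then show ?thesis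
          using dense P \<delta> that by (auto simp: dense_in_top_of_set_iff)
      qed
      ultimately obtain n where n: "n > max M M'" "\<And>l. l \<in> {1..N} \<Longrightarrow> dist ((?T l ^^ n) F) P < \<delta>"
        using d_hypercyclic_orbit_near_late[of N compact_ops ?T F P \<delta> "max M M'"] T_compact N \<delta> by auto
      have "\<exists>D\<in>compact_ops. \<exists>G. (\<forall>l\<in>{1..N}. G l \<in> compact_ops) \<and> approx_system N W r P n D G \<delta>"
        unfolding P_def
      proof (rule approx_system_if_orbit_near[OF basis U W M r_pos r_mono])
        show "F \<in> compact_ops" using F(1) by (simp add: d_hypercyclic_vector_def)
        show "norm (F - orth_proj (basis_span e m)) < \<delta>" using F(2) by (simp add: dist_norm P_def)
        show "norm ((op_power (W l) (r l * n) o\<^sub>L F o\<^sub>L op_power U (r l * n)) - orth_proj (basis_span e m)) < \<delta>"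
          if "l \<in> {1..N}" for l
          using n(2)[OF that] by (simp add: dist_norm P_def T_op_power_power)
      qed (use n(1) in auto)
      then show "\<exists>n>M'. \<exists>D\<in>compact_ops. \<exists>G. (\<forall>l\<in>{1..N}. G l \<in> compact_ops) \<and>
          approx_system N W r (orth_proj (basis_span e m)) n D G \<delta>"
        using n(1) unfolding P_def by (intro exI[of _ n]) simp
    qed
  next
    assume seq: "\<forall>m\<ge>1. ?sequences m"
    have approx: "\<exists>n. \<exists>D\<in>compact_ops. \<exists>G. (\<forall>l\<in>{1..N}. G l \<in> compact_ops) \<and>
        approx_system N W r (orth_proj (basis_span e m)) n D G \<delta>" if m: "m \<ge> 1" and \<delta>: "\<delta> > 0" for m \<delta>
      using seq[rule_format, OF m]
    proof (elim exE conjE)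
      fix D :: "nat \<Rightarrow> 'h \<Rightarrow>\<^sub>L 'h" and G :: "nat \<Rightarrow> nat \<Rightarrow> 'h \<Rightarrow>\<^sub>L 'h" and n :: "nat \<Rightarrow> nat"
      assume D: "\<forall>k. D k \<in> compact_ops"
        and G: "\<forall>l\<in>{1..N}. \<forall>k. G l k \<in> compact_ops"
        and lim: "\<forall>l\<in>{1..N}.
           (\<lambda>k. norm (D k - orth_proj (basis_span e m))) \<longlonglongrightarrow> 0 \<and>
           (\<lambda>k. norm (G l k - orth_proj (basis_span e m))) \<longlonglongrightarrow> 0 \<and>
           (\<lambda>k. norm (op_power (W l) (r l * n k) o\<^sub>L D k)) \<longlonglongrightarrow> 0 \<and>
           (\<lambda>k. norm (op_power (op_inverse (W l)) (r l * n k) o\<^sub>L G l k)) \<longlonglongrightarrow> 0"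
        and cross: "\<forall>s\<in>{1..N}. \<forall>l\<in>{1..N}. s \<noteq> l \<longrightarrow>
           (\<lambda>k. norm (op_power (W l) (r l * n k) o\<^sub>L
                      op_power (op_inverse (W s)) (r s * n k) o\<^sub>L G s k)) \<longlonglongrightarrow> 0"
      have "\<exists>k. approx_system N W r (orth_proj (basis_span e m)) (n k) (D k) (\<lambda>l. G l k) \<delta>"
        by (rule sequences_imp_approx_system) (rule bspec[OF lim] cross[rule_format] \<delta>; assumption)+
      then obtain k where "approx_system N W r (orth_proj (basis_span e m)) (n k) (D k) (\<lambda>l. G l k) \<delta>" ..
      then show ?thesis
        using D G by (intro exI[of _ "n k"] bexI[of _ "D k"] exI[of _ "\<lambda>l. G l k"]) auto
    qed
    obtain Q :: "('h \<Rightarrow>\<^sub>L 'h) set" where Q: "countable Q" "Q \<subseteq> compact_ops" "compact_ops \<subseteq> closure Q"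
      using compact_ops_separable[OF basis] by blast
    show ?dense
    proof (rule dense_d_hypercyclic_if_transitive[OF closed_compact_ops Q T_compact T_cont])
      fix x :: "'h \<Rightarrow>\<^sub>L 'h" and y :: "nat \<Rightarrow> 'h \<Rightarrow>\<^sub>L 'h" and \<epsilon> :: real
      assume "x \<in> compact_ops" "\<And>l. l \<in> {1..N} \<Longrightarrow> y l \<in> compact_ops" "\<epsilon> > 0"
      then show "\<exists>h\<in>compact_ops. dist h x < \<epsilon> \<and>
          (\<exists>n. \<forall>l\<in>{1..N}. dist ((?T l ^^ n) h) (y l) < \<epsilon>)"
        using N by (intro transitive_if_approx_systems[OF basis U W approx]) auto
    qed
  qed
qed

end
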